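(* Let $\Gamma=(V,E)$, $B$, $\mathbb{K}$, $u$ be as in the context. Suppose that $|E|\ge 240$, that $\chi(\Gamma,B)\ge 4$, that some vertex of $\Gamma$ is adjacent to at least $3$ boundary nodes, and that the graph $\Gamma\setminus B$ contains the wheel graph on $5$ vertices as an induced subgraph. Then $\mathcal{A}(\Gamma,u)$ is not combinatorially equivalent to any graphic arrangement, any ideal arrangement, any hypersolvable arrangement, or any central arrangement admitting an ordering with respect to which its minimal broken circuits are pairwise disjoint.
   Context: $\Gamma=(V,E)$ is a finite connected graph without loops or multiple edges; $B\subseteq V$ is a set of at least $2$ pairwise nonadjacent vertices (boundary nodes); $\mathbb{K}$ is a field of characteristic $0$; $u:B\to\mathbb{K}$ is injective. $\mathcal{A}(\Gamma,u)$ is the central arrangement in $\mathbb{K}^{(V\setminus B)\cup\{0\}}$ consisting of: for each edge $ij\in E$ with no endpoint in $B$, the hyperplane $x_i=x_j$; for each edge $ij$ with $j\in B$, the hyperplane $x_i=u(j)x_0$; and the hyperplane $x_0=0$. A crossing is the edge set of a minimal path in $\Gamma$ between two distinct boundary nodes. $\chi(\Gamma,B)$ is the chromatic number of the graph with vertex set $B$ in which $i,j$ are adjacent iff some crossing connects $i$ and $j$. The wheel graph on $5$ vertices is a $4$-cycle plus a vertex adjacent to all four cycle vertices. For a central arrangement $\mathcal{A}$, $M(\mathcal{A})$ is the matroid on $\mathcal{A}$ in which a set is independent iff its normal vectors are linearly independent; two central arrangements are combinatorially equivalent if their matroids are isomorphic. A graphic arrangement is, for a graph $H$ on $[n]$,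 the arrangement of hyperplanes $x_i=x_j$ ($ij$ an edge of $H$). An ideal arrangement is, for a finite root system $\Phi$ with positive roots $\Phi^+$ ordered by the root poset ($\beta\le\gamma$ iff $\gamma-\beta$ is a nonnegative combination of simple roots) and an order ideal $I\subseteq\Phi^+$, the arrangement of hyperplanes orthogonal to the roots in $I$ (a subarrangement of the Coxeter arrangement of $\Phi$). Hypersolvable: for $X\subseteq Y\subseteq\mathcal{A}$, the containment is closed if $X\ne Y$ and $\{a,b,c\}$ is independent for all distinct $a,b\in X$, $c\in Y\setminus X$; complete if $X\ne Y$ and for all distinct $a,b\in Y\setminus X$ there is $\gamma\in X$ with $\{a,b,\gamma\}$ dependent (for closed complete containments this $\gamma=f(a,b)$ is unique); solvable if closed, complete, and for all distinct $a,b,c\in Y\setminus X$ with $f(a,b),f(a,c),f(b,c)$ distinct, the set $\{f(a,b),f(a,c),f(b,c)\}$ is dependent. $\mathcal{A}$ is hypersolvable if there is a chain $X_1\subseteq\dots\subseteq X_k=\mathcal{A}$ with $|X_1|=1$ and each $X_i\subseteq X_{i+1}$ solvable. Given a total order on $\mathcal{A}$, the broken circuits are the sets $C\setminus\min C$ for circuits $C$ (minimal dependent sets); a broken circuit is minimal if it properly contains no broken circuit. *)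

theory Defs
  imports Complex_Main "HOL-Library.Function_Algebras"
begin

section \<open>Graphs\<close>

definition simple_graph :: "'v set \<Rightarrow> 'v set set \<Rightarrow> bool" where
  "simple_graph V E \<longleftrightarrow> finite V \<and> (\<forall>e\<in>E. e \<subseteq> V \<and> card e = 2)"

definition is_path :: "'v set \<Rightarrow> 'v set set \<Rightarrow> 'v list \<Rightarrow> bool" where
  "is_path V E p \<longleftrightarrow> p \<noteq> [] \<and> set p \<subseteq> V \<and> distinct p \<and>
     (\<forall>i. Suc i < length p \<longrightarrow> {p ! i, p ! Suc i} \<in> E)"

definition path_edges :: "'v list \<Rightarrow> 'v set set" where
  "path_edges p = {{p ! i, p ! Suc i} | i. Suc i < length p}"

definition connected_graph :: "'v set \<Rightarrow> 'v set set \<Rightarrow> bool" where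
  "connected_graph V E \<longleftrightarrow> V \<noteq> {} \<and>
     (\<forall>x\<in>V. \<forall>y\<in>V. \<exists>p. is_path V E p \<and> hd p = x \<and> last p = y)"

definition delete_verts_edges :: "'v set set \<Rightarrow> 'v set \<Rightarrow> 'v set set" where
  "delete_verts_edges E B = {e \<in> E. e \<inter> B = {}}"

definition contains_induced ::
    "'v set \<Rightarrow> 'v set set \<Rightarrow> 'w set \<Rightarrow> 'w set set \<Rightarrow> bool" where
  "contains_induced V E W F \<longleftrightarrow>
     (\<exists>f. inj_on f W \<and> f ` W \<subseteq> V \<and> (\<forall>i\<in>W. \<forall>j\<in>W. {i, j} \<in> F \<longleftrightarrow> {f i, f j} \<in> E))"

definition wheel5_verts :: "nat set" where
  "wheel5_verts = {0, 1, 2, 3, 4}"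

definition wheel5_edges :: "nat set set" where
  "wheel5_edges = {{0, 1}, {1, 2}, {2, 3}, {3, 0}, {4, 0}, {4, 1}, {4, 2}, {4, 3}}"

definition chromatic_number :: "'v set \<Rightarrow> ('v \<Rightarrow> 'v \<Rightarrow> bool) \<Rightarrow> nat" where
  "chromatic_number W adj = (LEAST k. \<exists>c :: 'v \<Rightarrow> nat.
     c ` W \<subseteq> {..<k} \<and> (\<forall>i\<in>W. \<forall>j\<in>W. adj i j \<longrightarrow> c i \<noteq> c j))"


section \<open>Boundary nodes and crossings\<close>

definition boundary_path :: "'v set \<Rightarrow> 'v set set \<Rightarrow> 'v set \<Rightarrow> 'v list \<Rightarrow> bool" where
  "boundary_path V E B p \<longleftrightarrow>
     is_path V E p \<and> hd p \<in> B \<and> last p \<in> B \<and> hd p \<noteq> last p"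

text \<open>Minimality is with respect to inclusion of edge sets among all paths between any two
  distinct boundary nodes. In particular a crossing meets \<open>B\<close> in its two ends only.\<close>

definition crossing :: "'v set \<Rightarrow> 'v set set \<Rightarrow> 'v set \<Rightarrow> 'v set set \<Rightarrow> bool" where
  "crossing V E B X \<longleftrightarrow>
     (\<exists>p. boundary_path V E B p \<and> X = path_edges p) \<and>
     (\<forall>q. boundary_path V E B q \<and> path_edges q \<subseteq> X \<longrightarrow> path_edges q = X)"

definition crossing_connects :: "'v set \<Rightarrow> 'v set set \<Rightarrow> 'v set \<Rightarrow> 'v \<Rightarrow> 'v \<Rightarrow> bool" where
  "crossing_connects V E B i j \<longleftrightarrow>
     (\<exists>p. boundary_path V E B p \<and> crossing V E B (path_edges p) \<and> hd p = i \<and> last p = j)"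

definition boundary_chromatic_number :: "'v set \<Rightarrow> 'v set set \<Rightarrow> 'v set \<Rightarrow> nat" where
  "boundary_chromatic_number V E B = chromatic_number B (crossing_connects V E B)"


section \<open>Central arrangements and their matroids\<close>

text \<open>For a finite set \<open>I\<close> the vector space \<open>\<bbbK>\<^sup>I\<close> is represented by the functions that
  vanish outside \<open>I\<close>. All notions below therefore take the index set \<open>I\<close> as an argument.\<close>

definition coord_space :: "'i set \<Rightarrow> ('i \<Rightarrow> 'k::field) set" where
  "coord_space I = {x. \<forall>i. i \<notin> I \<longrightarrow> x i = 0}"

definition dot :: "'i set \<Rightarrow> ('i \<Rightarrow> 'k::field) \<Rightarrow> ('i \<Rightarrow> 'k) \<Rightarrow> 'k" where
  "dot I a x = (\<Sum>i\<in>I. a i * x i)"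

definition fun_scale :: "'k::field \<Rightarrow> ('i \<Rightarrow> 'k) \<Rightarrow> 'i \<Rightarrow> 'k" where
  "fun_scale c x = (\<lambda>i. c * x i)"

interpretation fun_space: vector_space fun_scale
  by unfold_locales (auto simp: fun_scale_def algebra_simps fun_eq_iff)

definition hyperplane :: "'i set \<Rightarrow> ('i \<Rightarrow> 'k::field) \<Rightarrow> ('i \<Rightarrow> 'k) set" where
  "hyperplane I a = {x \<in> coord_space I. dot I a x = 0}"

definition normal_vector :: "'i set \<Rightarrow> ('i \<Rightarrow> 'k::field) set \<Rightarrow> ('i \<Rightarrow> 'k) \<Rightarrow> bool" where
  "normal_vector I H a \<longleftrightarrow> a \<in> coord_space I \<and> a \<noteq> 0 \<and> H = hyperplane I a"

definition central_arrangement :: "'i set \<Rightarrow> ('i \<Rightarrow> 'k::field) set set \<Rightarrow> bool" where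
  "central_arrangement I A \<longleftrightarrow> finite I \<and> finite A \<and> (\<forall>H\<in>A. \<exists>a. normal_vector I H a)"

text \<open>A normal vector is unique up to a nonzero scalar, so the choice of \<open>n\<close> is immaterial.
  Distinct hyperplanes have distinct normal vectors, so passing to the image set is harmless.\<close>

definition arr_indep :: "'i set \<Rightarrow> ('i \<Rightarrow> 'k::field) set set \<Rightarrow> bool" where
  "arr_indep I S \<longleftrightarrow>
     (\<exists>n. (\<forall>H\<in>S. normal_vector I H (n H)) \<and> fun_space.independent (n ` S))"

text \<open>A matroid is given by its ground set and its family of independent sets.\<close>

type_synonym 'a matroid = "'a set \<times> 'a set set"

definition arr_matroid ::
    "'i set \<Rightarrow> ('i \<Rightarrow> 'k::field) set set \<Rightarrow> ('i \<Rightarrow> 'k) set matroid" where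
  "arr_matroid I A = (A, {S. S \<subseteq> A \<and> arr_indep I S})"

definition matroid_isomorphic :: "'a matroid \<Rightarrow> 'b matroid \<Rightarrow> bool" where
  "matroid_isomorphic M N \<longleftrightarrow>
     (\<exists>f. bij_betw f (fst M) (fst N) \<and> (\<forall>S. S \<subseteq> fst M \<longrightarrow> (S \<in> snd M \<longleftrightarrow> f ` S \<in> snd N)))"

definition combinatorially_equivalent ::
    "'i set \<Rightarrow> ('i \<Rightarrow> 'k::field) set set \<Rightarrow> 'j set \<Rightarrow> ('j \<Rightarrow> 'l::field) set set \<Rightarrow> bool" where
  "combinatorially_equivalent I A J A' \<longleftrightarrow>
     matroid_isomorphic (arr_matroid I A) (arr_matroid J A')"


section \<open>The arrangement of a graph with boundary\<close>

text \<open>The index \<open>None\<close> plays the role of the extra coordinate \<open>0\<close>.\<close>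

definition dirichlet_index :: "'v set \<Rightarrow> 'v set \<Rightarrow> 'v option set" where
  "dirichlet_index V B = insert None (Some ` (V - B))"

definition dirichlet_arrangement ::
    "'v set \<Rightarrow> 'v set set \<Rightarrow> 'v set \<Rightarrow> ('v \<Rightarrow> 'k::field) \<Rightarrow> ('v option \<Rightarrow> 'k) set set" where
  "dirichlet_arrangement V E B u =
     {{x \<in> coord_space (dirichlet_index V B). x (Some i) = x (Some j)} | i j.
        {i, j} \<in> E \<and> i \<notin> B \<and> j \<notin> B} \<union>
     {{x \<in> coord_space (dirichlet_index V B). x (Some i) = u j * x None} | i j.
        {i, j} \<in> E \<and> j \<in> B} \<union>
     {{x \<in> coord_space (dirichlet_index V B). x None = 0}}"


section \<open>Graphic arrangements\<close>

definition graphic_arrangement :: "nat \<Rightarrow> (nat \<Rightarrow> 'k::field) set set \<Rightarrow> bool" where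
  "graphic_arrangement n A \<longleftrightarrow>
     (\<exists>F. simple_graph {1..n} F \<and> A = {{x \<in> coord_space {1..n}. x i = x j} | i j. {i, j} \<in> F})"


section \<open>Ideal arrangements\<close>

text \<open>Root systems live in the Euclidean space \<open>\<real>\<^sup>I\<close>. They are reduced, and they need neither
  be crystallographic nor irreducible nor span the space.\<close>

definition reflection :: "'i set \<Rightarrow> ('i \<Rightarrow> real) \<Rightarrow> ('i \<Rightarrow> real) \<Rightarrow> 'i \<Rightarrow> real" where
  "reflection I a x = x - fun_scale (2 * dot I a x / dot I a a) a"

definition root_system :: "'i set \<Rightarrow> ('i \<Rightarrow> real) set \<Rightarrow> bool" where
  "root_system I \<Phi> \<longleftrightarrow> finite I \<and> finite \<Phi> \<and> \<Phi> \<subseteq> coord_space I \<and> 0 \<notin> \<Phi> \<and>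
     (\<forall>\<alpha>\<in>\<Phi>. \<Phi> \<inter> {fun_scale c \<alpha> | c. True} = {\<alpha>, - \<alpha>}) \<and>
     (\<forall>\<alpha>\<in>\<Phi>. reflection I \<alpha> ` \<Phi> = \<Phi>)"

definition nonneg_comb :: "('i \<Rightarrow> real) set \<Rightarrow> ('i \<Rightarrow> real) \<Rightarrow> bool" where
  "nonneg_comb \<Delta> v \<longleftrightarrow>
     (\<exists>c. (\<forall>\<alpha>\<in>\<Delta>. c \<alpha> \<ge> 0) \<and> v = (\<Sum>\<alpha>\<in>\<Delta>. fun_scale (c \<alpha>) \<alpha>))"

definition simple_system :: "('i \<Rightarrow> real) set \<Rightarrow> ('i \<Rightarrow> real) set \<Rightarrow> bool" where
  "simple_system \<Phi> \<Delta> \<longleftrightarrow> \<Delta> \<subseteq> \<Phi> \<and> fun_space.independent \<Delta> \<and>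
     (\<forall>\<beta>\<in>\<Phi>. nonneg_comb \<Delta> \<beta> \<or> nonneg_comb \<Delta> (- \<beta>))"

definition positive_roots :: "('i \<Rightarrow> real) set \<Rightarrow> ('i \<Rightarrow> real) set \<Rightarrow> ('i \<Rightarrow> real) set" where
  "positive_roots \<Phi> \<Delta> = {\<beta> \<in> \<Phi>. nonneg_comb \<Delta> \<beta>}"

definition root_le :: "('i \<Rightarrow> real) set \<Rightarrow> ('i \<Rightarrow> real) \<Rightarrow> ('i \<Rightarrow> real) \<Rightarrow> bool" where
  "root_le \<Delta> \<beta> \<gamma> \<longleftrightarrow> nonneg_comb \<Delta> (\<gamma> - \<beta>)"

definition root_ideal ::
    "('i \<Rightarrow> real) set \<Rightarrow> ('i \<Rightarrow> real) set \<Rightarrow> ('i \<Rightarrow> real) set \<Rightarrow> bool" where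
  "root_ideal \<Phi> \<Delta> \<Psi> \<longleftrightarrow> \<Psi> \<subseteq> positive_roots \<Phi> \<Delta> \<and>
     (\<forall>\<gamma>\<in>\<Psi>. \<forall>\<beta>\<in>positive_roots \<Phi> \<Delta>. root_le \<Delta> \<beta> \<gamma> \<longrightarrow> \<beta> \<in> \<Psi>)"

definition ideal_arrangement :: "'i set \<Rightarrow> ('i \<Rightarrow> real) set set \<Rightarrow> bool" where
  "ideal_arrangement I A \<longleftrightarrow>
     (\<exists>\<Phi> \<Delta> \<Psi>. root_system I \<Phi> \<and> simple_system \<Phi> \<Delta> \<and> root_ideal \<Phi> \<Delta> \<Psi> \<and>
        A = hyperplane I ` \<Psi>)"


section \<open>Hypersolvable arrangements\<close>

definition closed_containment ::
    "'i set \<Rightarrow> ('i \<Rightarrow> 'k::field) set set \<Rightarrow> ('i \<Rightarrow> 'k) set set \<Rightarrow> bool" where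
  "closed_containment I X Y \<longleftrightarrow> X \<subseteq> Y \<and> X \<noteq> Y \<and>
     (\<forall>a\<in>X. \<forall>b\<in>X. \<forall>c\<in>Y - X. a \<noteq> b \<longrightarrow> arr_indep I {a, b, c})"

definition complete_containment ::
    "'i set \<Rightarrow> ('i \<Rightarrow> 'k::field) set set \<Rightarrow> ('i \<Rightarrow> 'k) set set \<Rightarrow> bool" where
  "complete_containment I X Y \<longleftrightarrow> X \<subseteq> Y \<and> X \<noteq> Y \<and>
     (\<forall>a\<in>Y - X. \<forall>b\<in>Y - X. a \<noteq> b \<longrightarrow> (\<exists>\<gamma>\<in>X. \<not> arr_indep I {a, b, \<gamma>}))"

text \<open>The hyperplane \<open>f(a, b)\<close>; it is unique for closed complete containments, which is the only
  situation in which it is used.\<close>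

definition third_hyperplane ::
    "'i set \<Rightarrow> ('i \<Rightarrow> 'k::field) set set \<Rightarrow> ('i \<Rightarrow> 'k) set \<Rightarrow> ('i \<Rightarrow> 'k) set \<Rightarrow> ('i \<Rightarrow> 'k) set" where
  "third_hyperplane I X a b = (THE \<gamma>. \<gamma> \<in> X \<and> \<not> arr_indep I {a, b, \<gamma>})"

definition solvable_containment ::
    "'i set \<Rightarrow> ('i \<Rightarrow> 'k::field) set set \<Rightarrow> ('i \<Rightarrow> 'k) set set \<Rightarrow> bool" where
  "solvable_containment I X Y \<longleftrightarrow> closed_containment I X Y \<and> complete_containment I X Y \<and>
     (let f = third_hyperplane I X in
      \<forall>a\<in>Y - X. \<forall>b\<in>Y - X. \<forall>c\<in>Y - X.
        distinct [a, b, c] \<and> distinct [f a b, f a c, f b c] \<longrightarrow>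
        \<not> arr_indep I {f a b, f a c, f b c})"

definition hypersolvable :: "'i set \<Rightarrow> ('i \<Rightarrow> 'k::field) set set \<Rightarrow> bool" where
  "hypersolvable I A \<longleftrightarrow>
     (\<exists>Xs. Xs \<noteq> [] \<and> card (hd Xs) = 1 \<and> last Xs = A \<and>
        (\<forall>i. Suc i < length Xs \<longrightarrow> solvable_containment I (Xs ! i) (Xs ! Suc i)))"


section \<open>Broken circuits\<close>

definition arr_circuit ::
    "'i set \<Rightarrow> ('i \<Rightarrow> 'k::field) set set \<Rightarrow> ('i \<Rightarrow> 'k) set set \<Rightarrow> bool" where
  "arr_circuit I A C \<longleftrightarrow> C \<subseteq> A \<and> \<not> arr_indep I C \<and> (\<forall>D. D \<subset> C \<longrightarrow> arr_indep I D)"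

text \<open>Here \<open>(a, b) \<in> r\<close> means that \<open>a\<close> is at most \<open>b\<close> in the given order.\<close>

definition broken_circuit ::
    "'i set \<Rightarrow> ('i \<Rightarrow> 'k::field) set set \<Rightarrow> ('i \<Rightarrow> 'k) set rel \<Rightarrow> ('i \<Rightarrow> 'k) set set \<Rightarrow> bool" where
  "broken_circuit I A r D \<longleftrightarrow>
     (\<exists>C m. arr_circuit I A C \<and> m \<in> C \<and> (\<forall>x\<in>C. (m, x) \<in> r) \<and> D = C - {m})"

definition minimal_broken_circuit ::
    "'i set \<Rightarrow> ('i \<Rightarrow> 'k::field) set set \<Rightarrow> ('i \<Rightarrow> 'k) set rel \<Rightarrow> ('i \<Rightarrow> 'k) set set \<Rightarrow> bool" where
  "minimal_broken_circuit I A r D \<longleftrightarrow>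
     broken_circuit I A r D \<and> \<not> (\<exists>D'. broken_circuit I A r D' \<and> D' \<subset> D)"

definition has_disjoint_minimal_broken_circuits ::
    "'i set \<Rightarrow> ('i \<Rightarrow> 'k::field) set set \<Rightarrow> bool" where
  "has_disjoint_minimal_broken_circuits I A \<longleftrightarrow>
     (\<exists>r. linear_order_on A r \<and> pairwise disjnt {D. minimal_broken_circuit I A r D})"

end

theory Submission
  imports Defs
begin

text \<open>Two configurations in the matroid of the Dirichlet arrangement obstruct all four equivalences.

  The three boundary edges at a vertex with three boundary neighbours and the hyperplane
  \<open>x\<^sub>0 = 0\<close> form a line with four points. In a graphic arrangement two points of a line
  determine the third, since it is the third edge of a triangle. In an ordered arrangement with least
  point \<open>m\<close> on such a line, the circuits \<open>{m, x, y}\<close> and \<open>{m, x, z}\<close> give two minimal broken circuits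
  meeting in \<open>x\<close>.

  The wheel in the interior excludes the other two classes. In a hypersolvable chain, consider the
  step at which the wheel is first contained. Closedness forces every triangle with a new element to
  have two of them, and then some two new elements span a line with no third point, contradicting
  completeness. In an ideal arrangement, two roots of the ideal at an acute angle span a plane
  containing a third root of the ideal. No two rim edges lie in a triangle, so the four rim roots are
  pairwise at non-acute angles; being positive, they are linearly independent, yet the rim is a
  circuit.\<close>

section \<open>Normal vectors and independence\<close>

lemma dot_add_right: "dot I a (x + y) = dot I a x + dot I a y"
  by (simp add: dot_def sum.distrib algebra_simps)

lemma dot_scale_right: "dot I a (fun_scale c x) = c * dot I a x"
  by (simp add: dot_def fun_scale_def sum_distrib_left algebra_simps)

lemma dot_commute: "dot I a x = dot I x a"
  by (simp add: dot_def mult.commute)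

lemma dot_diff_right: "dot I a (x - y) = dot I a x - dot I a y"
  by (simp add: dot_def sum_subtractf algebra_simps)

lemma dot_add_left: "dot I (x + y) a = dot I x a + dot I y a"
  by (simp add: dot_def sum.distrib algebra_simps)

lemma dot_scale_left: "dot I (fun_scale c x) a = c * dot I x a"
  by (simp add: dot_def fun_scale_def sum_distrib_left algebra_simps)

lemma dot_diff_left: "dot I (x - y) a = dot I x a - dot I y a"
  by (simp add: dot_def sum_subtractf algebra_simps)

lemma dot_zero_left [simp]: "dot I 0 x = 0"
  by (simp add: dot_def)

lemma dot_zero_right [simp]: "dot I x 0 = 0"
  by (simp add: dot_def)

lemmas dot_linear = dot_add_left dot_add_right dot_scale_left dot_scale_right
  dot_diff_left dot_diff_right

lemma dot_sum_left: "dot I (\<Sum>x\<in>S. g x) a = (\<Sum>x\<in>S. dot I (g x) a)"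
  by (induction S rule: infinite_finite_induct)
    (simp_all only: sum.infinite sum.empty sum.insert dot_add_left dot_zero_left if_False not_False_eq_True)

lemma dot_sum_right: "dot I a (\<Sum>x\<in>S. g x) = (\<Sum>x\<in>S. dot I a (g x))"
  by (induction S rule: infinite_finite_induct)
    (simp_all only: sum.infinite sum.empty sum.insert dot_add_right dot_zero_right if_False not_False_eq_True)

lemma coord_space_add: "x \<in> coord_space I \<Longrightarrow> y \<in> coord_space I \<Longrightarrow> x + y \<in> coord_space I"
  by (simp add: coord_space_def)

lemma coord_space_diff: "x \<in> coord_space I \<Longrightarrow> y \<in> coord_space I \<Longrightarrow> x - y \<in> coord_space I"
  by (simp add: coord_space_def)

lemma coord_space_scale: "x \<in> coord_space I \<Longrightarrow> fun_scale c x \<in> coord_space I"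
  by (simp add: coord_space_def fun_scale_def)

text \<open>The standard basis vector of a coordinate, from which all explicit normals below are
  built.\<close>

definition unit_vec :: "'i \<Rightarrow> 'i \<Rightarrow> 'k::field" where
  "unit_vec i = (\<lambda>k. if k = i then 1 else 0)"

lemma dot_unit_vec: "finite I \<Longrightarrow> i \<in> I \<Longrightarrow> dot I (unit_vec i) x = x i"
  by (simp add: dot_def unit_vec_def if_distrib[of "\<lambda>c. c * _"] cong: if_cong)

lemma unit_vec_coord_space: "i \<in> I \<Longrightarrow> unit_vec i \<in> coord_space I"
  by (auto simp: coord_space_def unit_vec_def)

text \<open>Fix \<open>i\<close> with \<open>a i \<noteq> 0\<close>. The vectors with entry
  \<open>a i\<close> at \<open>j\<close> and \<open>- a j\<close> at \<open>i\<close> lie on the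
  hyperplane of \<open>a\<close>. Evaluating \<open>b\<close> on them gives
  \<open>a i * b j = a j * b i\<close> for every \<open>j\<close>, which is proportionality with
  factor \<open>b i / a i\<close>.\<close>

lemma normal_vector_unique:
  assumes "finite I" "normal_vector I H a" "normal_vector I H b"
  shows "\<exists>c. c \<noteq> 0 \<and> b = fun_scale c a"
proof -
  from assms have a: "a \<in> coord_space I" "a \<noteq> 0" and b: "b \<in> coord_space I" "b \<noteq> 0"
    and eq: "hyperplane I a = hyperplane I b"
    by (auto simp: normal_vector_def)
  from a(2) obtain i where i: "a i \<noteq> 0" by (auto simp: fun_eq_iff)
  with a have iI: "i \<in> I" by (auto simp: coord_space_def)
  have *: "a i * b j = a j * b i" for j
  proof (cases "j \<in> I")
    case False
    then show ?thesis using a b by (simp add: coord_space_def)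
  next
    case True
    define x where "x = fun_scale (a i) (unit_vec j) - fun_scale (a j) (unit_vec i)"
    have x: "x \<in> coord_space I" unfolding x_def
      using True iI by (intro coord_space_diff coord_space_scale unit_vec_coord_space)
    have d: "dot I y x = a i * y j - a j * y i" for y
      using assms(1) True iI
      by (simp add: x_def dot_diff_right dot_scale_right dot_commute[of I y] dot_unit_vec)
    have "x \<in> hyperplane I a" using x by (simp add: hyperplane_def d)
    then have "x \<in> hyperplane I b" using eq by simp
    then show ?thesis by (simp add: hyperplane_def d)
  qed
  have "b j = b i / a i * a j" for j using *[of j] i by (simp add: field_simps)
  then have "b = fun_scale (b i / a i) a" unfolding fun_scale_def by (rule ext)
  moreover from this b(2) have "b i / a i \<noteq> 0" by (metis fun_space.scale_zero_left)
  ultimately show ?thesis by blast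
qed

text \<open>Two choices of normals differ by nonzero factors, which can be absorbed into the
  coefficients, so any convenient choice \<open>n\<close> decides independence. Coefficients may be
  indexed by hyperplanes because distinct hyperplanes have distinct normals.\<close>

lemma arr_indep_iff:
  assumes I: "finite I" and S: "finite S" and n: "\<And>H. H \<in> S \<Longrightarrow> normal_vector I H (n H)"
  shows "arr_indep I S \<longleftrightarrow>
    (\<forall>c. (\<Sum>H\<in>S. fun_scale (c H) (n H)) = 0 \<longrightarrow> (\<forall>H\<in>S. c H = 0))"
proof -
  define lin where "lin m \<longleftrightarrow>
    (\<forall>c. (\<Sum>H\<in>S. fun_scale (c H) (m H)) = 0 \<longrightarrow> (\<forall>H\<in>S. c H = 0))"
    for m :: "('a \<Rightarrow> 'b) set \<Rightarrow> 'a \<Rightarrow> 'b"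
  have ind: "fun_space.independent (m ` S) \<longleftrightarrow> lin m"
    if m: "\<And>H. H \<in> S \<Longrightarrow> normal_vector I H (m H)" for m
  proof -
    have inj: "inj_on m S"
    proof (rule inj_onI)
      fix H K assume "H \<in> S" "K \<in> S" "m H = m K"
      then show "H = K" using m[of H] m[of K] by (simp add: normal_vector_def)
    qed
    have "fun_space.dependent (m ` S) \<longleftrightarrow>
      (\<exists>w. (\<exists>H\<in>S. w (m H) \<noteq> 0) \<and> (\<Sum>H\<in>S. fun_scale (w (m H)) (m H)) = 0)"
      using S by (simp add: fun_space.dependent_finite sum.reindex[OF inj] bex_simps)
    also have "\<dots> \<longleftrightarrow> (\<exists>c. (\<exists>H\<in>S. c H \<noteq> 0) \<and> (\<Sum>H\<in>S. fun_scale (c H) (m H)) = 0)"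
    proof
      assume "\<exists>w. (\<exists>H\<in>S. w (m H) \<noteq> 0) \<and> (\<Sum>H\<in>S. fun_scale (w (m H)) (m H)) = 0"
      then obtain w where "\<exists>H\<in>S. w (m H) \<noteq> 0" "(\<Sum>H\<in>S. fun_scale (w (m H)) (m H)) = 0" by blast
      then show "\<exists>c. (\<exists>H\<in>S. c H \<noteq> 0) \<and> (\<Sum>H\<in>S. fun_scale (c H) (m H)) = 0"
        by (intro exI[of _ "\<lambda>H. w (m H)"]) simp
    next
      assume "\<exists>c. (\<exists>H\<in>S. c H \<noteq> 0) \<and> (\<Sum>H\<in>S. fun_scale (c H) (m H)) = 0"
      then obtain c where c: "\<exists>H\<in>S. c H \<noteq> 0" "(\<Sum>H\<in>S. fun_scale (c H) (m H)) = 0" by blast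
      define w where "w = (\<lambda>v. c (inv_into S m v))"
      have "w (m H) = c H" if "H \<in> S" for H using that inj by (simp add: w_def)
      then show "\<exists>w. (\<exists>H\<in>S. w (m H) \<noteq> 0) \<and> (\<Sum>H\<in>S. fun_scale (w (m H)) (m H)) = 0"
        using c by (intro exI[of _ w]) simp
    qed
    finally show ?thesis unfolding lin_def by blast
  qed
  have "lin n" if m: "\<And>H. H \<in> S \<Longrightarrow> normal_vector I H (m H)" and "lin m" for m
  proof -
    have "\<forall>H\<in>S. \<exists>d. d \<noteq> 0 \<and> n H = fun_scale d (m H)"
      using normal_vector_unique[OF I] m n by blast
    then obtain d where d: "\<And>H. H \<in> S \<Longrightarrow> d H \<noteq> 0 \<and> n H = fun_scale (d H) (m H)" by metis
    show ?thesis unfolding lin_def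
    proof (intro allI impI)
      fix c assume 0: "(\<Sum>H\<in>S. fun_scale (c H) (n H)) = 0"
      have "(\<Sum>H\<in>S. fun_scale (c H) (n H)) = (\<Sum>H\<in>S. fun_scale (c H * d H) (m H))"
        by (intro sum.cong) (use d in \<open>auto simp: fun_scale_def mult.assoc\<close>)
      with 0 have "(\<Sum>H\<in>S. fun_scale (c H * d H) (m H)) = 0" by simp
      with \<open>lin m\<close> have "\<forall>H\<in>S. c H * d H = 0"
        unfolding lin_def by (elim allE[of _ "\<lambda>H. c H * d H"]) simp
      then show "\<forall>H\<in>S. c H = 0" using d by simp
    qed
  qed
  then have "arr_indep I S \<longleftrightarrow> lin n"
    unfolding arr_indep_def using ind n by blast
  then show ?thesis by (simp add: lin_def)
qed

text \<open>A nontrivial relation between two nonzero normals has both coefficients nonzero, so the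
  two hyperplanes coincide. The case \<open>H = K\<close> is included in order to cover
  singletons.\<close>

lemma arr_indep_pair:
  assumes "finite I" "normal_vector I H a" "normal_vector I K b"
  shows "arr_indep I {H, K}"
proof (cases "H = K")
  case True
  then show ?thesis
    using assms by (subst arr_indep_iff[where n = "\<lambda>_. a"])
      (auto simp: normal_vector_def fun_scale_def fun_eq_iff)
next
  case False
  define n where "n = (\<lambda>L. if L = H then a else b)"
  have "arr_indep I {H, K} \<longleftrightarrow>
    (\<forall>c. (\<Sum>L\<in>{H, K}. fun_scale (c L) (n L)) = 0 \<longrightarrow> (\<forall>L\<in>{H, K}. c L = 0))"
    using assms False by (intro arr_indep_iff) (auto simp: n_def)
  also have "\<dots>"
  proof (intro allI impI)
    fix c assume "(\<Sum>L\<in>{H, K}. fun_scale (c L) (n L)) = 0"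
    then have 0: "fun_scale (c H) a + fun_scale (c K) b = 0" using False by (simp add: n_def)
    have a: "a \<noteq> 0" and b: "b \<noteq> 0" using assms by (auto simp: normal_vector_def)
    show "\<forall>L\<in>{H, K}. c L = 0"
    proof (cases "c K = 0")
      case True
      then show ?thesis using 0 a by (auto simp: fun_scale_def fun_eq_iff)
    next
      case K: False
      have eq: "c H * dot I a x + c K * dot I b x = 0" for x
        using arg_cong[OF 0, of "\<lambda>v. dot I v x"] by (simp add: dot_linear)
      have "c H \<noteq> 0" using 0 b K by (auto simp: fun_scale_def fun_eq_iff)
      with K have "dot I a x = 0 \<longleftrightarrow> dot I b x = 0" for x
        using eq[of x] by auto
      then have "hyperplane I b = hyperplane I a" by (simp add: hyperplane_def)
      then show ?thesis using False assms by (simp add: normal_vector_def)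
    qed
  qed
  finally show ?thesis .
qed

text \<open>Pairing a relation with the test point \<open>x\<close> kills the terms of
  \<open>H\<close> and \<open>K\<close>, hence the coefficient of \<open>L\<close> vanishes and the
  pair \<open>H\<close>, \<open>K\<close> remains. All independent triples below are certified by
  such a point.\<close>

lemma arr_indep_triple:
  assumes "finite I" "normal_vector I H a" "normal_vector I K b" "normal_vector I L c"
    and "H \<noteq> K" and x: "x \<in> H" "x \<in> K" "x \<notin> L"
  shows "arr_indep I {H, K, L}"
proof -
  have L: "L \<noteq> H" "L \<noteq> K" using x by auto
  define n where "n = (\<lambda>M. if M = H then a else if M = K then b else c)"
  have n: "normal_vector I M (n M)" if "M \<in> {H, K, L}" for M
    using that assms by (auto simp: n_def)
  have "arr_indep I {H, K, L} \<longleftrightarrow>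
    (\<forall>d. (\<Sum>M\<in>{H, K, L}. fun_scale (d M) (n M)) = 0 \<longrightarrow> (\<forall>M\<in>{H, K, L}. d M = 0))"
    using assms n by (intro arr_indep_iff) auto
  also have "\<dots>"
  proof (intro allI impI)
    fix d assume "(\<Sum>M\<in>{H, K, L}. fun_scale (d M) (n M)) = 0"
    then have 0: "fun_scale (d H) (n H) + (fun_scale (d K) (n K) + fun_scale (d L) (n L)) = 0"
      using assms(5) L by simp
    have "dot I (n H) x = 0" "dot I (n K) x = 0" "dot I (n L) x \<noteq> 0"
      using n[of H] n[of K] n[of L] x by (auto simp: normal_vector_def hyperplane_def)
    then have dL: "d L = 0"
      using arg_cong[OF 0, of "\<lambda>v. dot I v x"] by (simp add: dot_linear)
    have "arr_indep I {H, K}" using assms by (intro arr_indep_pair)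
    then have "\<forall>M\<in>{H, K}. d M = 0"
      using 0 dL assms(1,5) n arr_indep_iff[of I "{H, K}" n]
      by (auto simp: fun_scale_def zero_fun_def[symmetric])
    with dL show "\<forall>M\<in>{H, K, L}. d M = 0" by auto
  qed
  finally show ?thesis .
qed

lemma arr_dependent:
  assumes "finite I" "finite S" "\<And>H. H \<in> S \<Longrightarrow> normal_vector I H (n H)"
    and "(\<Sum>H\<in>S. fun_scale (c H) (n H)) = 0" "K \<in> S" "c K \<noteq> 0"
  shows "\<not> arr_indep I S"
  using arr_indep_iff[OF assms(1-3)] assms(4-6) by blast

section \<open>Hyperplanes of edges\<close>

text \<open>Indexed by the edge as a set, so that no order of the endpoints is chosen and edges can
  be moved by taking images.\<close>

definition edge_hyp :: "'i set \<Rightarrow> 'i set \<Rightarrow> ('i \<Rightarrow> 'k::field) set" where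
  "edge_hyp I e = {x \<in> coord_space I. \<forall>i\<in>e. \<forall>j\<in>e. x i = x j}"

lemma edge_hyp_pair: "edge_hyp I {i, j} = {x \<in> coord_space I. x i = x j}"
  by (auto simp: edge_hyp_def)

lemma unit_vec_diff_neq_zero: "i \<noteq> j \<Longrightarrow> unit_vec i - unit_vec j \<noteq> 0"
  by (auto simp: unit_vec_def fun_eq_iff)

lemma normal_edge_hyp:
  assumes "finite I" "i \<in> I" "j \<in> I" "i \<noteq> j"
  shows "normal_vector I (edge_hyp I {i, j}) (unit_vec i - unit_vec j)"
  using assms unit_vec_diff_neq_zero[of i j]
  by (auto simp: normal_vector_def edge_hyp_pair hyperplane_def dot_diff_left dot_unit_vec
      intro!: coord_space_diff unit_vec_coord_space)

lemma normal_edge_hyp_ex: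
  assumes "finite I" "e \<subseteq> I" "card e = 2"
  shows "\<exists>a. normal_vector I (edge_hyp I e) a"
proof -
  from assms(3) obtain i j where "e = {i, j}" "i \<noteq> j" by (auto simp: card_2_iff)
  then show ?thesis using assms normal_edge_hyp[of I i j] by blast
qed

text \<open>Indicator vectors supply the test points for \<open>arr_indep_triple\<close>.\<close>

definition ind_vec :: "'i set \<Rightarrow> 'i \<Rightarrow> 'k::field" where
  "ind_vec T = (\<lambda>i. if i \<in> T then 1 else 0)"

lemma ind_vec_edge_hyp:
  "T \<subseteq> I \<Longrightarrow> ind_vec T \<in> edge_hyp I e \<longleftrightarrow> e \<subseteq> T \<or> e \<inter> T = {}"
  unfolding edge_hyp_def ind_vec_def coord_space_def by auto

text \<open>If \<open>e\<close> has an endpoint \<open>i\<close> outside \<open>e'\<close>, the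
  indicator vector of \<open>{i}\<close> lies on the hyperplane of \<open>e'\<close> but not on that
  of \<open>e\<close>.\<close>

lemma edge_hyp_inject:
  assumes "e \<subseteq> I" "e' \<subseteq> I" "card e = 2" "card e' = 2"
  shows "edge_hyp I e = (edge_hyp I e' :: ('i \<Rightarrow> 'k::field) set) \<longleftrightarrow> e = e'"
proof
  assume eq: "edge_hyp I e = (edge_hyp I e' :: ('i \<Rightarrow> 'k) set)"
  show "e = e'"
  proof (rule ccontr)
    assume "e \<noteq> e'"
    have "finite e" "finite e'" using assms by (auto intro: card_ge_0_finite)
    with \<open>e \<noteq> e'\<close> have "\<not> e \<subseteq> e'" using assms card_subset_eq[of e' e] by auto
    then obtain i where i: "i \<in> e" "i \<notin> e'" by auto
    have "ind_vec {i} \<in> (edge_hyp I e' :: ('i \<Rightarrow> 'k) set)" using assms i by (subst ind_vec_edge_hyp) auto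
    then have "ind_vec {i} \<in> (edge_hyp I e :: ('i \<Rightarrow> 'k) set)" using eq by simp
    then have "e \<subseteq> {i}" using i assms by (subst (asm) ind_vec_edge_hyp) auto
    then have "card e \<le> 1" using card_mono[of "{i}" e] by simp
    then show False using assms by simp
  qed
qed auto

text \<open>The sets \<open>T\<close> in \<open>sep\<close> are the unions of connected components of the graph with edges \<open>e\<close>, \<open>e'\<close>.\<close>

lemma third_edge_cases:
  assumes "card e = 2" "card e' = 2" "card d = 2"
    and sep: "\<And>T. T \<subseteq> e \<union> e' \<union> d \<Longrightarrow> e \<subseteq> T \<or> e \<inter> T = {} \<Longrightarrow> e' \<subseteq> T \<or> e' \<inter> T = {} \<Longrightarrow>
      d \<subseteq> T \<or> d \<inter> T = {}"
  shows "d = e \<or> d = e' \<or> d = (e \<union> e') - (e \<inter> e')"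
proof -
  obtain i j where e: "e = {i, j}" "i \<noteq> j" using assms(1) by (auto simp: card_2_iff)
  obtain k l where e': "e' = {k, l}" "k \<noteq> l" using assms(2) by (auto simp: card_2_iff)
  obtain p q where d: "d = {p, q}" "p \<noteq> q" using assms(3) by (auto simp: card_2_iff)
  \<comment> \<open>An endpoint of \<open>d\<close> outside both other edges could be cut off by
    itself, and this cut would separate \<open>d\<close>.\<close>
  have in_ee: "p \<in> e \<union> e'" if "d = {p, q}" "p \<noteq> q" for p q
    using sep[of "{p}"] that by auto
  have dee: "p \<in> e \<union> e'" "q \<in> e \<union> e'" using in_ee[of p q] in_ee[of q p] d by auto
  show ?thesis
  proof (cases "e \<inter> e' = {}")
    case True
    then have "d \<subseteq> e \<or> d \<inter> e = {}" "d \<subseteq> e' \<or> d \<inter> e' = {}"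
      using sep[of e] sep[of e'] by auto
    then have "d \<subseteq> e \<or> d \<subseteq> e'" using dee d by auto
    then show ?thesis using assms(1-3) by (metis card_subset_eq card.infinite zero_neq_numeral)
  next
    case False
    \<comment> \<open>Edges with a common vertex cover at most three vertices, whose pairs are
      exactly the listed alternatives.\<close>
    then show ?thesis using dee e e' d by auto
  qed
qed

text \<open>By \<open>third_edge_cases\<close> some vertex set \<open>T\<close> is respected by
  \<open>e\<close> and \<open>e'\<close> but cuts \<open>d\<close>. Its indicator vector is the test
  point. For edges with one common vertex, the symmetric difference is the third side of their
  triangle.\<close>

lemma edge_triple_indep:
  assumes I: "finite I" and e: "e \<subseteq> I" "e' \<subseteq> I" "d \<subseteq> I" "card e = 2" "card e' = 2" "card d = 2"
    and "e \<noteq> e'" "d \<noteq> e" "d \<noteq> e'" "d \<noteq> (e \<union> e') - (e \<inter> e')"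
  shows "arr_indep I {edge_hyp I e, edge_hyp I e', edge_hyp I d :: ('i \<Rightarrow> 'k::field) set}"
proof -
  have "\<exists>T. T \<subseteq> e \<union> e' \<union> d \<and> (e \<subseteq> T \<or> e \<inter> T = {}) \<and> (e' \<subseteq> T \<or> e' \<inter> T = {}) \<and>
    \<not> (d \<subseteq> T \<or> d \<inter> T = {})"
  proof (rule ccontr)
    assume no: "\<not> ?thesis"
    then have "d = e \<or> d = e' \<or> d = (e \<union> e') - (e \<inter> e')"
    proof (intro third_edge_cases[OF e(4-6)])
      fix T assume "T \<subseteq> e \<union> e' \<union> d" "e \<subseteq> T \<or> e \<inter> T = {}" "e' \<subseteq> T \<or> e' \<inter> T = {}"
      with no show "d \<subseteq> T \<or> d \<inter> T = {}" by metis
    qed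
    then show False using assms(9-11) by metis
  qed
  then obtain T where T: "T \<subseteq> e \<union> e' \<union> d" "e \<subseteq> T \<or> e \<inter> T = {}" "e' \<subseteq> T \<or> e' \<inter> T = {}"
    "\<not> (d \<subseteq> T \<or> d \<inter> T = {})"
    by (elim exE conjE)
  then have TI: "T \<subseteq> I" using e by auto
  obtain a b c where n: "normal_vector I (edge_hyp I e) (a :: 'i \<Rightarrow> 'k)"
    "normal_vector I (edge_hyp I e') (b :: 'i \<Rightarrow> 'k)" "normal_vector I (edge_hyp I d) (c :: 'i \<Rightarrow> 'k)"
    using normal_edge_hyp_ex[OF I] e by meson
  have "edge_hyp I e \<noteq> (edge_hyp I e' :: ('i \<Rightarrow> 'k) set)"
    using edge_hyp_inject[of e I e'] e assms by auto
  then show ?thesis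
    using arr_indep_triple[OF I n, of "ind_vec T"] T ind_vec_edge_hyp[OF TI] by metis
qed

text \<open>The normals telescope: the differences along \<open>i, j\<close> and \<open>j, k\<close>
  add up to the difference along \<open>i, k\<close>.\<close>

lemma triangle_dependent:
  assumes I: "finite I" "{i, j, k} \<subseteq> I" and "distinct [i, j, k]"
  shows "\<not> arr_indep I {edge_hyp I {i, j}, edge_hyp I {j, k}, edge_hyp I {i, k} :: ('i \<Rightarrow> 'k::field) set}"
proof -
  let ?H = "edge_hyp I {i, j} :: ('i \<Rightarrow> 'k) set" and ?K = "edge_hyp I {j, k} :: ('i \<Rightarrow> 'k) set"
    and ?L = "edge_hyp I {i, k} :: ('i \<Rightarrow> 'k) set"
  define n where "n = (\<lambda>M. if M = ?H then unit_vec i - unit_vec j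
    else if M = ?K then unit_vec j - unit_vec k else unit_vec i - unit_vec k :: 'i \<Rightarrow> 'k)"
  have dist: "?H \<noteq> ?K" "?H \<noteq> ?L" "?K \<noteq> ?L"
    using assms by (auto simp: edge_hyp_inject doubleton_eq_iff)
  show ?thesis
  proof (rule arr_dependent[where n = n and c = "\<lambda>M. if M = ?L then - 1 else 1" and K = ?L])
    show "normal_vector I M (n M)" if "M \<in> {?H, ?K, ?L}" for M
      using that assms by (auto simp: n_def normal_edge_hyp)
    show "(\<Sum>M\<in>{?H, ?K, ?L}. fun_scale (if M = ?L then - 1 else 1) (n M)) = 0"
      using dist by (simp add: n_def)
  qed (use I in auto)
qed

text \<open>The same telescoping along a path of three edges, closed by the fourth.\<close>

lemma quadrangle_dependent:
  assumes I: "finite I" "{i, j, k, l} \<subseteq> I" and "distinct [i, j, k, l]"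
  shows "\<not> arr_indep I {edge_hyp I {i, j}, edge_hyp I {j, k}, edge_hyp I {k, l},
    edge_hyp I {i, l} :: ('i \<Rightarrow> 'k::field) set}"
proof -
  let ?H = "edge_hyp I {i, j} :: ('i \<Rightarrow> 'k) set" and ?K = "edge_hyp I {j, k} :: ('i \<Rightarrow> 'k) set"
    and ?L = "edge_hyp I {k, l} :: ('i \<Rightarrow> 'k) set" and ?N = "edge_hyp I {i, l} :: ('i \<Rightarrow> 'k) set"
  define n where "n = (\<lambda>M. if M = ?H then unit_vec i - unit_vec j
    else if M = ?K then unit_vec j - unit_vec k else if M = ?L then unit_vec k - unit_vec l
    else unit_vec i - unit_vec l :: 'i \<Rightarrow> 'k)"
  have dist: "?H \<noteq> ?K" "?H \<noteq> ?L" "?K \<noteq> ?L" "?H \<noteq> ?N" "?K \<noteq> ?N" "?L \<noteq> ?N"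
    using assms by (auto simp: edge_hyp_inject doubleton_eq_iff)
  show ?thesis
  proof (rule arr_dependent[where n = n and c = "\<lambda>M. if M = ?N then - 1 else 1" and K = ?N])
    show "normal_vector I M (n M)" if "M \<in> {?H, ?K, ?L, ?N}" for M
      using that assms by (auto simp: n_def normal_edge_hyp)
    show "(\<Sum>M\<in>{?H, ?K, ?L, ?N}. fun_scale (if M = ?N then - 1 else 1) (n M)) = 0"
      using dist by (simp add: n_def)
  qed (use I in auto)
qed

section \<open>Matroid patterns\<close>

text \<open>Phrased through dependent triples only, hence in the language of the matroid. In a
  central arrangement distinct hyperplanes are pairwise independent, so the four elements span a
  flat of rank two.\<close>

definition four_point_line :: "'i set \<Rightarrow> ('i \<Rightarrow> 'k::field) set set \<Rightarrow> bool" where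
  "four_point_line I A \<longleftrightarrow>
     (\<exists>Q\<subseteq>A. card Q = 4 \<and> (\<forall>T\<subseteq>Q. card T = 3 \<longrightarrow> \<not> arr_indep I T))"

text \<open>A flat of rank two with no third element. Such flats obstruct completeness in a
  hypersolvable chain and acute angles in a root ideal.\<close>

definition two_point_line ::
    "'i set \<Rightarrow> ('i \<Rightarrow> 'k::field) set set \<Rightarrow> ('i \<Rightarrow> 'k) set \<Rightarrow> ('i \<Rightarrow> 'k) set \<Rightarrow> bool" where
  "two_point_line I A a b \<longleftrightarrow> a \<in> A \<and> b \<in> A \<and> a \<noteq> b \<and>
     (\<forall>c\<in>A. c \<noteq> a \<longrightarrow> c \<noteq> b \<longrightarrow> arr_indep I {a, b, c})"

section \<open>Transfer of patterns along matroid isomorphisms\<close>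

lemma combinatorially_equivalentE:
  assumes "combinatorially_equivalent I A J A'"
  obtains f where "bij_betw f A A'" "\<And>S. S \<subseteq> A \<Longrightarrow> arr_indep J (f ` S) \<longleftrightarrow> arr_indep I S"
proof -
  from assms obtain f where f: "bij_betw f A A'"
    "\<And>S. S \<subseteq> A \<Longrightarrow> arr_indep I S \<longleftrightarrow> f ` S \<subseteq> A' \<and> arr_indep J (f ` S)"
    unfolding combinatorially_equivalent_def matroid_isomorphic_def arr_matroid_def by auto
  then have "f ` S \<subseteq> A'" if "S \<subseteq> A" for S using that by (auto simp: bij_betw_def)
  with f that show ?thesis by metis
qed

lemma four_point_line_transfer:
  assumes "four_point_line I A" "combinatorially_equivalent I A J A'"
  shows "four_point_line J A'"
proof -
  from assms(1) obtain Q where Q: "Q \<subseteq> A" "card Q = 4"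
    "\<And>T. T \<subseteq> Q \<Longrightarrow> card T = 3 \<Longrightarrow> \<not> arr_indep I T"
    unfolding four_point_line_def by blast
  from assms(2) obtain f where f: "bij_betw f A A'"
    "\<And>S. S \<subseteq> A \<Longrightarrow> arr_indep J (f ` S) \<longleftrightarrow> arr_indep I S"
    by (rule combinatorially_equivalentE) blast
  have inj: "inj_on f Q" using f(1) Q(1) by (metis bij_betw_def inj_on_subset)
  have "\<not> arr_indep J T'" if T': "T' \<subseteq> f ` Q" "card T' = 3" for T'
  proof -
    from T'(1) obtain T where T: "T \<subseteq> Q" "T' = f ` T" by (meson subset_imageE)
    then have "card T = 3" using T'(2) inj by (metis card_image inj_on_subset)
    then show ?thesis using T Q f(2)[of T] by auto
  qed
  moreover have "f ` Q \<subseteq> A'" "card (f ` Q) = 4"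
    using f(1) Q inj by (auto simp: bij_betw_def card_image)
  ultimately show ?thesis unfolding four_point_line_def by blast
qed

text \<open>The condition ranges over all of \<open>A'\<close>, so a candidate third element is
  first pulled back by surjectivity of \<open>f\<close>.\<close>

lemma two_point_line_transfer:
  assumes "two_point_line I A a b" and f: "bij_betw f A A'"
    "\<And>S. S \<subseteq> A \<Longrightarrow> arr_indep J (f ` S) \<longleftrightarrow> arr_indep I S"
  shows "two_point_line J A' (f a) (f b)"
proof -
  have ab: "a \<in> A" "b \<in> A" "a \<noteq> b" using assms(1) by (auto simp: two_point_line_def)
  have "arr_indep J {f a, f b, c'}" if "c' \<in> A'" "c' \<noteq> f a" "c' \<noteq> f b" for c'
  proof -
    from that f(1) obtain c where c: "c \<in> A" "c' = f c" by (auto simp: bij_betw_def)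
    then show ?thesis using f(2)[of "{a, b, c}"] ab assms(1) that by (auto simp: two_point_line_def)
  qed
  moreover have "f a \<noteq> f b" using ab f(1) by (auto simp: bij_betw_def inj_on_def)
  ultimately show ?thesis using ab f(1) by (auto simp: two_point_line_def bij_betw_def)
qed

section \<open>Arrangements without lines of four points\<close>

lemma card_4E:
  assumes "card Q = 4"
  obtains a b c d where "Q = {a, b, c, d}" "distinct [a, b, c, d]"
proof -
  have "finite Q" using assms by (intro card_ge_0_finite) simp
  then obtain xs where xs: "set xs = Q" "distinct xs" using finite_distinct_list by blast
  then have "length xs = Suc (Suc (Suc (Suc 0)))" using assms distinct_card[of xs] by simp
  then obtain a b c d where "xs = [a, b, c, d]" by (auto simp: length_Suc_conv)
  with xs that show ?thesis by auto
qed

lemma graphic_no_four_point_line: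
  assumes "graphic_arrangement n A"
  shows "\<not> four_point_line {1..n} A"
proof
  let ?h = "edge_hyp {1..n}"
  from assms obtain F where F: "simple_graph {1..n} F"
    and A: "A = {{x \<in> coord_space {1..n}. x i = x j} | i j. {i, j} \<in> F}"
    unfolding graphic_arrangement_def by blast
  have e: "e \<subseteq> {1..n}" "card e = 2" if "e \<in> F" for e using F that by (auto simp: simple_graph_def)
  have A: "A \<subseteq> ?h ` F" using A by (auto simp: edge_hyp_pair[symmetric])
  assume "four_point_line {1..n} A"
  then obtain Q where Q: "Q \<subseteq> A" "card Q = 4" "\<And>T. T \<subseteq> Q \<Longrightarrow> card T = 3 \<Longrightarrow> \<not> arr_indep {1..n} T"
    unfolding four_point_line_def by blast
  obtain a b c d where abcd: "Q = {a, b, c, d}" "distinct [a, b, c, d]"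
    using Q(2) by (rule card_4E)
  then have "a \<in> ?h ` F" "b \<in> ?h ` F" "c \<in> ?h ` F" "d \<in> ?h ` F" using A Q(1) by auto
  then obtain p q r s where pqrs: "p \<in> F" "q \<in> F" "r \<in> F" "s \<in> F"
    "a = ?h p" "b = ?h q" "c = ?h r" "d = ?h s"
    by (elim imageE)
  \<comment> \<open>The edges of the first two points determine the edge of any further point on the
    line, so the third and fourth points coincide.\<close>
  have "t = (p \<union> q) - (p \<inter> q)" if "t \<in> F" "?h t \<in> {c, d}" for t
  proof (rule ccontr)
    assume neq: "t \<noteq> (p \<union> q) - (p \<inter> q)"
    have "p \<noteq> q" "t \<noteq> p" "t \<noteq> q" using that(2) pqrs(5-8) abcd(2) by auto
    then have "arr_indep {1..n} {?h p, ?h q, ?h t}"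
      using e[OF pqrs(1)] e[OF pqrs(2)] e[OF that(1)] neq
      by (intro edge_triple_indep finite_atLeastAtMost)
    then have "arr_indep {1..n} {a, b, ?h t}" using pqrs(5,6) by simp
    moreover from that(2) have "?h t = c \<or> ?h t = d" by simp
    then have "card {a, b, ?h t} = 3 \<and> {a, b, ?h t} \<subseteq> Q"
    proof
      assume "?h t = c"
      then show ?thesis using abcd(2) by (simp add: abcd(1))
    next
      assume "?h t = d"
      then show ?thesis using abcd(2) by (simp add: abcd(1))
    qed
    ultimately show False using Q(3) by blast
  qed
  from this[of r] this[of s] have "r = s" using pqrs by simp
  then show False using abcd pqrs by simp
qed

text \<open>Consequently circuits have at least three elements and broken circuits at least
  two.\<close>

lemma central_small_indep:
  assumes "central_arrangement I A" "S \<subseteq> A" "card S \<le> 2"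
  shows "arr_indep I S"
proof -
  have I: "finite I" "finite S" and n: "\<And>H. H \<in> A \<Longrightarrow> \<exists>a. normal_vector I H a"
    using assms finite_subset by (auto simp: central_arrangement_def)
  have "card S = 0 \<or> card S = 1 \<or> card S = 2" using assms(3) by linarith
  then consider "S = {}" | H where "S = {H}" | H K where "S = {H, K}"
    using I by (auto simp: card_1_singleton_iff card_2_iff)
  then show ?thesis
  proof cases
    case 1
    then show ?thesis by (simp add: arr_indep_def fun_space.independent_empty)
  next
    case (2 H)
    then obtain a where "normal_vector I H a" using n assms(2) by blast
    then show ?thesis using 2 arr_indep_pair[of I H a H a] I by simp
  next
    case (3 H K)
    then have "H \<in> A" "K \<in> A" using assms(2) by auto
    with n obtain a b where "normal_vector I H a" "normal_vector I K b" by meson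
    then show ?thesis using 3 arr_indep_pair[of I H a K b] I by simp
  qed
qed

lemma linear_order_least:
  assumes "linear_order_on A r" "finite Q" "Q \<noteq> {}" "Q \<subseteq> A"
  shows "\<exists>m\<in>Q. \<forall>x\<in>Q. (m, x) \<in> r"
  using assms(2-4)
proof (induction Q rule: finite_ne_induct)
  case (singleton x)
  then show ?case using assms(1) by (auto simp: order_on_defs refl_on_def)
next
  case (insert x F)
  then obtain m where m: "m \<in> F" "\<forall>y\<in>F. (m, y) \<in> r" by auto
  have r: "(x, x) \<in> r" "trans r" "(m, x) \<in> r \<or> (x, m) \<in> r"
    using assms(1) insert m by (auto simp: order_on_defs refl_on_def total_on_def)
  show ?case
  proof (cases "(m, x) \<in> r")
    case True
    then show ?thesis using m by auto
  next
    case False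
    then have "(x, m) \<in> r" using r by blast
    then have "\<forall>y\<in>F. (x, y) \<in> r" using m(2) r(2) by (meson transD)
    then show ?thesis using r(1) by auto
  qed
qed

text \<open>The triple is a circuit because its proper subsets have at most two elements. A broken
  circuit properly inside \<open>{x, y}\<close> would have at most one element and would come from a
  circuit with at most two.\<close>

lemma minimal_broken_circuit_four_point_line:
  assumes A: "central_arrangement I A" and "{m, x, y} \<subseteq> A" "distinct [m, x, y]"
    and dep: "\<not> arr_indep I {m, x, y}" and r: "\<forall>z\<in>{m, x, y}. (m, z) \<in> r"
  shows "minimal_broken_circuit I A r {x, y}"
proof -
  have small: "card D \<le> 2" if "D \<subset> {m, x, y}" for D
    using psubset_card_mono[OF _ that] assms(3) by simp
  have "arr_circuit I A {m, x, y}"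
    unfolding arr_circuit_def using central_small_indep[OF A] small assms(2) dep
    by (meson order.trans psubset_imp_subset)
  moreover have "{x, y} = {m, x, y} - {m}" using assms(3) by auto
  ultimately have broken: "broken_circuit I A r {x, y}"
    unfolding broken_circuit_def using r by blast
  have False if "broken_circuit I A r D" "D \<subset> {x, y}" for D
  proof -
    from that(1) obtain C m' where C: "arr_circuit I A C" "m' \<in> C" "D = C - {m'}"
      unfolding broken_circuit_def by blast
    have "card D \<le> 1"
      using psubset_card_mono[OF _ that(2)] card_insert_le_m1[of 2 "{y}" x] by simp
    moreover have "finite D" using that(2) finite_subset by blast
    moreover have "C = insert m' D" using C by blast
    ultimately have "card C \<le> 2" by (simp add: card_insert_if)
    then show False using central_small_indep[OF A, of C] C(1) by (simp add: arr_circuit_def)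
  qed
  with broken show ?thesis unfolding minimal_broken_circuit_def by blast
qed

lemma disjoint_broken_circuits_no_four_point_line:
  assumes A: "central_arrangement I A" and disj: "has_disjoint_minimal_broken_circuits I A"
  shows "\<not> four_point_line I A"
proof
  assume "four_point_line I A"
  then obtain Q where Q: "Q \<subseteq> A" "card Q = 4" "\<And>T. T \<subseteq> Q \<Longrightarrow> card T = 3 \<Longrightarrow> \<not> arr_indep I T"
    unfolding four_point_line_def by blast
  from disj obtain r where r: "linear_order_on A r"
    and disj: "pairwise disjnt {D. minimal_broken_circuit I A r D}"
    unfolding has_disjoint_minimal_broken_circuits_def by blast
  have "finite Q" "Q \<noteq> {}" using Q(2) by (auto intro: card_ge_0_finite)
  then obtain m where m: "m \<in> Q" "\<forall>x\<in>Q. (m, x) \<in> r"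
    using linear_order_least[OF r] Q(1) by blast
  then have "card (Q - {m}) = 3" using Q(2) by simp
  then obtain x y z where xyz: "Q - {m} = {x, y, z}" "x \<noteq> y" "x \<noteq> z" "y \<noteq> z"
    by (auto simp: card_3_iff)
  then have Qeq: "x \<in> Q" "y \<in> Q" "z \<in> Q" and ne: "m \<noteq> x" "m \<noteq> y" "m \<noteq> z" by auto
  \<comment> \<open>Being least in \<open>Q\<close>, the point \<open>m\<close> is the one removed
    from both triples, and \<open>x\<close> remains in both broken circuits.\<close>
  have mbc: "minimal_broken_circuit I A r {x, t}" if "t \<in> {y, z}" for t
  proof (rule minimal_broken_circuit_four_point_line[OF A])
    have "t \<in> Q" "t \<noteq> m" "t \<noteq> x" using that Qeq ne xyz by auto
    then show "{m, x, t} \<subseteq> A" "distinct [m, x, t]" "\<not> arr_indep I {m, x, t}"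
      "\<forall>z\<in>{m, x, t}. (m, z) \<in> r"
      using m Q(1) Q(3)[of "{m, x, t}"] Qeq ne by auto
  qed
  have "{x, y} \<noteq> {x, z}" using xyz by (auto simp: doubleton_eq_iff)
  then have "disjnt {x, y} {x, z}" using pairwiseD[OF disj, of "{x, y}" "{x, z}"] mbc[of y] mbc[of z] by simp
  then show False by (simp add: disjnt_def)
qed

text \<open>The wheel on five vertices with spokes \<open>s\<close> and rim edges \<open>r\<close>, where \<open>r i\<close> completes the triangle
  on \<open>s i\<close> and its successor.\<close>

definition wheel_pattern ::
    "'i set \<Rightarrow> ('i \<Rightarrow> 'k::field) set set \<Rightarrow> (nat \<Rightarrow> ('i \<Rightarrow> 'k) set) \<Rightarrow> (nat \<Rightarrow> ('i \<Rightarrow> 'k) set) \<Rightarrow> bool"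
  where
  "wheel_pattern I A s r \<longleftrightarrow>
     (\<forall>i<4. s i \<in> A \<and> r i \<in> A) \<and>
     (\<forall>i<4. let j = (i + 1) mod 4; k = (i + 3) mod 4 in
        distinct [s i, s j, r i] \<and> \<not> arr_indep I {s i, s j, r i} \<and>
        two_point_line I A (s j) (s k) \<and> two_point_line I A (s j) (r k) \<and>
        two_point_line I A (r i) (s k) \<and> two_point_line I A (r i) (r k)) \<and>
     two_point_line I A (r 0) (r 2) \<and> two_point_line I A (r 1) (r 3) \<and>
     \<not> arr_indep I {r 0, r 1, r 2, r 3}"

text \<open>Around the rim \<open>j\<close> is the successor and \<open>k\<close> the predecessor of
  \<open>i\<close>; adding 3 modulo 4 avoids subtraction on natural numbers.\<close>

lemma wheel_patternD:
  assumes "wheel_pattern I A s r" "i < 4" "j = (i + 1) mod 4" "k = (i + 3) mod 4"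
  shows "s i \<in> A" "r i \<in> A" "s i \<noteq> s j" "s i \<noteq> r i" "s j \<noteq> r i"
    and "\<not> arr_indep I {s i, s j, r i}"
    and "two_point_line I A (s j) (s k)" "two_point_line I A (s j) (r k)"
    and "two_point_line I A (r i) (s k)" "two_point_line I A (r i) (r k)"
  using assms unfolding wheel_pattern_def Let_def by simp_all

lemma wheel_pattern_transfer:
  assumes w: "wheel_pattern I A s r" and f: "bij_betw f A A'"
    "\<And>S. S \<subseteq> A \<Longrightarrow> arr_indep J (f ` S) \<longleftrightarrow> arr_indep I S"
  shows "wheel_pattern J A' (f \<circ> s) (f \<circ> r)"
proof -
  have sr: "s i \<in> A" "r i \<in> A" if "i < 4" for i using w that by (auto simp: wheel_pattern_def)
  have inj: "f a = f b \<longleftrightarrow> a = b" if "a \<in> A" "b \<in> A" for a b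
    using f(1) that by (auto simp: bij_betw_def inj_on_def)
  have fA: "f a \<in> A'" if "a \<in> A" for a using f(1) that by (auto simp: bij_betw_def)
  have line: "two_point_line J A' (f a) (f b)" if "two_point_line I A a b" for a b
    using two_point_line_transfer[OF that f] .
  have tri: "arr_indep J {f a, f b, f c} \<longleftrightarrow> arr_indep I {a, b, c}"
    if "a \<in> A" "b \<in> A" "c \<in> A" for a b c
    using f(2)[of "{a, b, c}"] that by simp
  have quad: "arr_indep J {f (r 0), f (r 1), f (r 2), f (r 3)} \<longleftrightarrow> arr_indep I {r 0, r 1, r 2, r 3}"
    using f(2)[of "{r 0, r 1, r 2, r 3}"] sr by simp
  show ?thesis
    using w unfolding wheel_pattern_def Let_def o_def quad
    by (auto simp: sr fA inj tri intro!: line)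
qed

lemma hypersolvable_no_wheel:
  assumes "hypersolvable I A"
  shows "\<not> wheel_pattern I A s r"
proof
  assume w: "wheel_pattern I A s r"
  from assms obtain Xs where Xs: "Xs \<noteq> []" "card (hd Xs) = 1" "last Xs = A"
    and step: "\<And>i. Suc i < length Xs \<Longrightarrow> solvable_containment I (Xs ! i) (Xs ! Suc i)"
    unfolding hypersolvable_def by blast
  have last: "Xs ! (length Xs - 1) = A" using Xs by (simp add: last_conv_nth)
  \<comment> \<open>The chain increases, so all its members lie in \<open>A\<close>. A third element
    found in \<open>X\<close> can then be tested against \<open>two_point_line\<close>, which speaks
    of \<open>A\<close>.\<close>
  have sub: "Xs ! i \<subseteq> A" if "i < length Xs" for i
  proof -
    from that have "i \<le> length Xs - 1" by simp
    then have "Xs ! i \<subseteq> Xs ! (length Xs - 1)"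
    proof (induction rule: inc_induct)
      case (step n)
      then have "Xs ! n \<subseteq> Xs ! Suc n"
        using \<open>\<And>i. Suc i < length Xs \<Longrightarrow> solvable_containment I (Xs ! i) (Xs ! Suc i)\<close>[of n]
        by (simp add: solvable_containment_def closed_containment_def)
      then show ?case using step by blast
    qed simp
    then show ?thesis using last by simp
  qed
  define Z where "Z = s ` {..<4} \<union> r ` {..<4}"
  have ZA: "Z \<subseteq> A" using w by (auto simp: Z_def wheel_pattern_def)
  \<comment> \<open>The step of the chain at which the wheel is completed. It is not the first
    member, which is a singleton while the wheel has distinct spokes.\<close>
  define n where "n = (LEAST n. n < length Xs \<and> Z \<subseteq> Xs ! n)"
  have n: "n < length Xs" "Z \<subseteq> Xs ! n"
    using LeastI[of "\<lambda>n. n < length Xs \<and> Z \<subseteq> Xs ! n" "length Xs - 1"] Xs(1) last ZA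
    unfolding n_def by auto
  have "n \<noteq> 0"
  proof
    assume "n = 0"
    then have "Z \<subseteq> hd Xs" using n Xs(1) by (simp add: hd_conv_nth)
    moreover obtain H where "hd Xs = {H}" using Xs(2) by (auto simp: card_1_singleton_iff)
    ultimately have "Z \<subseteq> {H}" by simp
    then have "s 0 \<in> {H}" "s 1 \<in> {H}" unfolding Z_def by (simp_all add: image_subset_iff)
    then have "s 0 = s 1" by simp
    then show False using wheel_patternD(3)[OF w, of 0 1] by simp
  qed
  then obtain m where m: "n = Suc m" by (cases n) auto
  define X where "X = Xs ! m"
  define Y where "Y = Xs ! n"
  have "\<not> Z \<subseteq> X"
    using not_less_Least[of m "\<lambda>n. n < length Xs \<and> Z \<subseteq> Xs ! n"] m n by (auto simp: X_def n_def)
  have XA: "X \<subseteq> A" using sub m n by (simp add: X_def)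
  have "solvable_containment I X Y" using step[of m] m n by (simp add: X_def Y_def)
  then have "closed_containment I X Y" "complete_containment I X Y"
    by (simp_all add: solvable_containment_def)
  then have closed: "\<And>a b c. a \<in> X \<Longrightarrow> b \<in> X \<Longrightarrow> c \<in> Y - X \<Longrightarrow> a \<noteq> b \<Longrightarrow> arr_indep I {a, b, c}"
    and complete: "\<And>a b. a \<in> Y - X \<Longrightarrow> b \<in> Y - X \<Longrightarrow> a \<noteq> b \<Longrightarrow> \<exists>\<gamma>\<in>X. \<not> arr_indep I {a, b, \<gamma>}"
    unfolding closed_containment_def complete_containment_def by simp_all
  have Y: "s i \<in> Y" "r i \<in> Y" if "i < 4" for i using n that by (auto simp: Z_def Y_def)
  \<comment> \<open>If both were new, completeness would put a third element of \<open>X\<close> on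
    their line.\<close>
  have line: "a \<in> X \<or> b \<in> X" if ab: "two_point_line I A a b" "a \<in> Y" "b \<in> Y" for a b
  proof (rule ccontr)
    assume no: "\<not> ?thesis"
    then obtain \<gamma> where \<gamma>: "\<gamma> \<in> X" "\<not> arr_indep I {a, b, \<gamma>}"
      using complete[of a b] ab by (auto simp: two_point_line_def)
    moreover have "\<gamma> \<noteq> a" "\<gamma> \<noteq> b" using \<gamma> no by auto
    ultimately show False using ab(1) XA by (auto simp: two_point_line_def)
  qed
  \<comment> \<open>Closedness: a new element is never on a line with two old ones.\<close>
  have triangle: "a \<notin> X \<or> b \<notin> X"
    if "\<not> arr_indep I {a, b, c}" "a \<noteq> b" "c \<in> Y" "c \<notin> X" for a b c
    using closed[of a b c] that by blast
  \<comment> \<open>Two triangles contain the spoke \<open>s i\<close>, with remaining sides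
    \<open>s j\<close>, \<open>r i\<close> and \<open>s k\<close>, \<open>r k\<close>. If
    \<open>s i\<close> is new, each triangle has a second new side. Any side of the first and any
    side of the second form a two-point line, so they cannot both be new.\<close>
  have spoke: "s i \<in> X" if i: "i < 4" for i
  proof (rule ccontr)
    assume no: "s i \<notin> X"
    define j where "j = (i + 1) mod 4"
    define k where "k = (i + 3) mod 4"
    have jk: "j < 4" "k < 4" "i = (k + 1) mod 4" using i unfolding j_def k_def by presburger+
    note wi = wheel_patternD[OF w i j_def k_def]
    note wk = wheel_patternD[OF w jk(2,3) refl]
    have "s j \<notin> X \<or> r i \<notin> X"
      using triangle[of "s j" "r i" "s i"] wi(5,6) no Y i by (simp add: insert_commute)
    moreover have "s k \<notin> X \<or> r k \<notin> X"
      using triangle[of "s k" "r k" "s i"] wk(4,6) no Y i by (simp add: insert_commute)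
    moreover have "s j \<in> X \<or> s k \<in> X" "s j \<in> X \<or> r k \<in> X" "r i \<in> X \<or> s k \<in> X"
      "r i \<in> X \<or> r k \<in> X"
      using line[OF wi(7)] line[OF wi(8)] line[OF wi(9)] line[OF wi(10)] Y i jk(1,2) by auto
    ultimately show False by blast
  qed
  \<comment> \<open>With all spokes old, a new rim edge would lie on a line with two old
    spokes.\<close>
  have "r i \<in> X" if i: "i < 4" for i
  proof (rule ccontr)
    assume no: "r i \<notin> X"
    have "(i + 1) mod 4 < 4" by simp
    then show False
      using triangle[of "s i" "s ((i + 1) mod 4)" "r i"] wheel_patternD(3,6)[OF w i refl refl]
        spoke i no Y by blast
  qed
  then have "Z \<subseteq> X" using spoke unfolding Z_def by blast
  then show False using \<open>\<not> Z \<subseteq> X\<close> by blast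
qed

section \<open>Ideals of root systems\<close>

lemma coord_space_sum: "(\<And>x. x \<in> S \<Longrightarrow> g x \<in> coord_space I) \<Longrightarrow> (\<Sum>x\<in>S. g x) \<in> coord_space I"
  by (induction S rule: infinite_finite_induct) (simp_all add: coord_space_def)

lemma dot_self_pos:
  fixes x :: "'i \<Rightarrow> real"
  assumes "finite I" "x \<in> coord_space I" "x \<noteq> 0"
  shows "dot I x x > 0"
proof -
  from assms(3) obtain i where i: "x i \<noteq> 0" by (auto simp: fun_eq_iff)
  with assms(2) have "i \<in> I" by (auto simp: coord_space_def)
  with i assms(1) show ?thesis
    unfolding dot_def by (intro sum_pos2[of I i]) (auto simp: zero_less_mult_iff)
qed

text \<open>Only meaningful on the span of \<open>\<Delta>\<close>, for a finite independent set \<open>\<Delta>\<close>.\<close>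

definition height :: "('i \<Rightarrow> real) set \<Rightarrow> ('i \<Rightarrow> real) \<Rightarrow> real" where
  "height \<Delta> v = (\<Sum>\<alpha>\<in>\<Delta>. fun_space.representation \<Delta> v \<alpha>)"

locale root_ideal_setting =
  fixes I :: "'i set" and \<Phi> \<Delta> \<Psi> :: "('i \<Rightarrow> real) set"
  assumes root_sys: "root_system I \<Phi>" and simple_sys: "simple_system \<Phi> \<Delta>"
    and ideal: "root_ideal \<Phi> \<Delta> \<Psi>"
begin

abbreviation pos :: "('i \<Rightarrow> real) set" where
  "pos \<equiv> positive_roots \<Phi> \<Delta>"

abbreviation ht :: "('i \<Rightarrow> real) \<Rightarrow> real" where
  "ht \<equiv> height \<Delta>"

lemma finite_index: "finite I" and finite_roots: "finite \<Phi>"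
  using root_sys by (auto simp: root_system_def)

lemma root_coord_space: "\<alpha> \<in> \<Phi> \<Longrightarrow> \<alpha> \<in> coord_space I"
  and root_neq_zero: "\<alpha> \<in> \<Phi> \<Longrightarrow> \<alpha> \<noteq> 0"
  using root_sys by (auto simp: root_system_def)

lemma reflection_root: "\<alpha> \<in> \<Phi> \<Longrightarrow> \<beta> \<in> \<Phi> \<Longrightarrow> reflection I \<alpha> \<beta> \<in> \<Phi>"
  using root_sys unfolding root_system_def by blast

lemma uminus_root: "\<alpha> \<in> \<Phi> \<Longrightarrow> - \<alpha> \<in> \<Phi>"
  using root_sys unfolding root_system_def by blast

lemma proportional_root: "\<alpha> \<in> \<Phi> \<Longrightarrow> fun_scale c \<alpha> \<in> \<Phi> \<Longrightarrow> fun_scale c \<alpha> = \<alpha> \<or> fun_scale c \<alpha> = - \<alpha>"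
  using root_sys unfolding root_system_def by blast

lemma simple_root: "\<alpha> \<in> \<Delta> \<Longrightarrow> \<alpha> \<in> \<Phi>" and simple_indep: "fun_space.independent \<Delta>"
  using simple_sys by (auto simp: simple_system_def)

lemma finite_simple: "finite \<Delta>"
  using finite_roots simple_root by (meson finite_subset subsetI)

lemma pos_root: "\<beta> \<in> pos \<Longrightarrow> \<beta> \<in> \<Phi>" and pos_comb: "\<beta> \<in> pos \<Longrightarrow> nonneg_comb \<Delta> \<beta>"
  by (auto simp: positive_roots_def)

lemma pos_or_neg: "\<beta> \<in> \<Phi> \<Longrightarrow> \<beta> \<in> pos \<or> - \<beta> \<in> pos"
  using simple_sys uminus_root by (auto simp: simple_system_def positive_roots_def)

lemma finite_pos: "finite pos"
  using finite_roots pos_root by (meson finite_subset subsetI)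

lemma dot_root_pos: "\<beta> \<in> \<Phi> \<Longrightarrow> dot I \<beta> \<beta> > 0"
  using dot_self_pos finite_index root_coord_space root_neq_zero by blast

lemma ideal_pos: "\<beta> \<in> \<Psi> \<Longrightarrow> \<beta> \<in> pos"
  using ideal by (auto simp: root_ideal_def)

lemma comb_span: "nonneg_comb \<Delta> v \<Longrightarrow> v \<in> fun_space.span \<Delta>"
  unfolding nonneg_comb_def
  by (auto intro!: fun_space.span_sum intro: fun_space.span_scale fun_space.span_base)

section \<open>Heights of positive roots\<close>

lemma ht_zero: "ht 0 = 0"
  by (simp add: height_def fun_space.representation_zero)

lemma ht_add:
  "v \<in> fun_space.span \<Delta> \<Longrightarrow> w \<in> fun_space.span \<Delta> \<Longrightarrow> ht (v + w) = ht v + ht w"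
  unfolding height_def
  by (simp add: fun_space.representation_add[OF simple_indep] sum.distrib)

lemma ht_scale: "v \<in> fun_space.span \<Delta> \<Longrightarrow> ht (fun_scale c v) = c * ht v"
  unfolding height_def
  by (simp add: fun_space.representation_scale[OF simple_indep] sum_distrib_left)

lemma ht_diff:
  "v \<in> fun_space.span \<Delta> \<Longrightarrow> w \<in> fun_space.span \<Delta> \<Longrightarrow> ht (v - w) = ht v - ht w"
  unfolding height_def
  by (simp add: fun_space.representation_diff[OF simple_indep] sum_subtractf)

text \<open>Independence of \<Delta> identifies the coefficients of the combination with its
  representation, so \<open>ht\<close> is the usual height.\<close>

lemma ht_comb: "ht (\<Sum>\<alpha>\<in>\<Delta>. fun_scale (c \<alpha>) \<alpha>) = (\<Sum>\<alpha>\<in>\<Delta>. c \<alpha>)"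
proof -
  have "fun_space.representation \<Delta> (\<Sum>\<alpha>\<in>\<Delta>. fun_scale (c \<alpha>) \<alpha>) \<gamma> = c \<gamma>" if "\<gamma> \<in> \<Delta>" for \<gamma>
  proof -
    have "fun_space.representation \<Delta> (\<Sum>\<alpha>\<in>\<Delta>. fun_scale (c \<alpha>) \<alpha>) \<gamma> =
      (\<Sum>\<alpha>\<in>\<Delta>. fun_space.representation \<Delta> (fun_scale (c \<alpha>) \<alpha>) \<gamma>)"
      by (subst fun_space.representation_sum[OF simple_indep])
        (auto intro: fun_space.span_scale fun_space.span_base)
    also have "\<dots> = (\<Sum>\<alpha>\<in>\<Delta>. if \<alpha> = \<gamma> then c \<alpha> else 0)"
      by (intro sum.cong refl)
        (simp add: fun_space.representation_scale[OF simple_indep] fun_space.span_base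
          fun_space.representation_basis[OF simple_indep])
    finally show ?thesis using that finite_simple by simp
  qed
  then show ?thesis unfolding height_def by simp
qed

text \<open>The height is strictly positive because a root is nonzero, so its nonnegative
  coefficients cannot all vanish.\<close>

lemma ht_pos:
  assumes "\<beta> \<in> pos"
  shows "ht \<beta> > 0"
proof -
  obtain c where c: "\<And>\<alpha>. \<alpha> \<in> \<Delta> \<Longrightarrow> c \<alpha> \<ge> 0" "\<beta> = (\<Sum>\<alpha>\<in>\<Delta>. fun_scale (c \<alpha>) \<alpha>)"
    using pos_comb[OF assms] unfolding nonneg_comb_def by auto
  have "\<exists>\<alpha>\<in>\<Delta>. c \<alpha> \<noteq> 0"
  proof (rule ccontr)
    assume "\<not> ?thesis"
    then have "\<beta> = (\<Sum>\<alpha>\<in>\<Delta>. 0)" unfolding c(2) by (intro sum.cong) auto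
    then show False using root_neq_zero[OF pos_root[OF assms]] by simp
  qed
  then show ?thesis
    unfolding c(2) ht_comb using c(1) finite_simple
    by (metis less_eq_real_def sum_pos2)
qed

lemma pos_span: "\<beta> \<in> pos \<Longrightarrow> \<beta> \<in> fun_space.span \<Delta>"
  using pos_comb comb_span by blast

lemma ht_uminus: "v \<in> fun_space.span \<Delta> \<Longrightarrow> ht (- v) = - ht v"
  using ht_scale[of v "- 1"] by (simp add: fun_space.scale_minus_left)

text \<open>Reducedness leaves only the two signs, and the heights rule out the negative
  one.\<close>

lemma pos_proportional:
  assumes "\<beta> \<in> pos" "\<gamma> \<in> pos" "\<gamma> = fun_scale c \<beta>"
  shows "\<gamma> = \<beta>"
proof -
  have "\<gamma> = \<beta> \<or> \<gamma> = - \<beta>" using proportional_root[of \<beta> c] assms pos_root by auto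
  moreover have "\<gamma> \<noteq> - \<beta>"
    using ht_pos[OF assms(1)] ht_pos[OF assms(2)] ht_uminus[OF pos_span[OF assms(1)]] by auto
  ultimately show ?thesis by blast
qed

text \<open>Reflecting at a non-obtuse angle subtracts a nonnegative multiple of a positive root,
  which is a step down in the root poset.\<close>

lemma ideal_reflection:
  assumes "\<gamma> \<in> \<Psi>" "\<beta> \<in> pos" "dot I \<beta> \<gamma> \<ge> 0" "reflection I \<beta> \<gamma> \<in> pos"
  shows "reflection I \<beta> \<gamma> \<in> \<Psi>"
proof -
  define c where "c = 2 * dot I \<beta> \<gamma> / dot I \<beta> \<beta>"
  have c: "c \<ge> 0" using assms(3) dot_root_pos[OF pos_root[OF assms(2)]] by (simp add: c_def)
  obtain d where d: "\<And>\<alpha>. \<alpha> \<in> \<Delta> \<Longrightarrow> d \<alpha> \<ge> 0" "\<beta> = (\<Sum>\<alpha>\<in>\<Delta>. fun_scale (d \<alpha>) \<alpha>)"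
    using pos_comb[OF assms(2)] unfolding nonneg_comb_def by auto
  have "\<gamma> - reflection I \<beta> \<gamma> = fun_scale c \<beta>" by (simp add: reflection_def c_def)
  also have "\<dots> = (\<Sum>\<alpha>\<in>\<Delta>. fun_scale (c * d \<alpha>) \<alpha>)"
    by (subst d(2)) (simp add: fun_space.scale_sum_right)
  finally have "root_le \<Delta> (reflection I \<beta> \<gamma>) \<gamma>"
    unfolding root_le_def nonneg_comb_def using c d(1)
    by (intro exI[of _ "\<lambda>\<alpha>. c * d \<alpha>"]) simp
  then show ?thesis using assms ideal unfolding root_ideal_def by blast
qed

text \<open>A root of the plane at which \<open>f / ht\<close> is minimal is simple in the rank two subsystem.\<close>

lemma reflection_extremal:
  assumes P: "\<And>\<delta>. \<delta> \<in> pos \<Longrightarrow> \<delta> \<in> P \<Longrightarrow> f p * ht \<delta> \<le> f \<delta> * ht p"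
    and sep: "\<And>\<delta>. \<delta> \<in> pos \<Longrightarrow> \<delta> \<in> P \<Longrightarrow> f p * ht \<delta> = f \<delta> * ht p \<Longrightarrow> \<delta> = p"
    and lin: "\<And>x y. f (x + y) = f x + f y" "\<And>c x. f (fun_scale c x) = c * f x"
    and plane: "\<And>x y c. x \<in> P \<Longrightarrow> y \<in> P \<Longrightarrow> fun_scale c x - y \<in> P"
    and p: "p \<in> pos" "p \<in> P" and \<delta>: "\<delta> \<in> pos" "\<delta> \<in> P" "\<delta> \<noteq> p"
  shows "reflection I p \<delta> \<in> pos"
proof (rule ccontr)
  assume "reflection I p \<delta> \<notin> pos"
  then have neg: "- reflection I p \<delta> \<in> pos"
    using pos_or_neg reflection_root p \<delta> pos_root by blast
  define c where "c = 2 * dot I p \<delta> / dot I p p"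
  \<comment> \<open>This is the negated reflection. Since \<open>\<epsilon> + \<delta>\<close> is a
    multiple of \<open>p\<close>, the two minimality inequalities add up to an equality, so each of
    them is an equality and \<open>sep\<close> applies.\<close>
  define \<epsilon> where "\<epsilon> = fun_scale c p - \<delta>"
  have \<epsilon>: "\<epsilon> \<in> pos" "\<epsilon> \<in> P"
    using neg plane p \<delta> by (simp_all add: \<epsilon>_def c_def reflection_def)
  have sum: "\<epsilon> + \<delta> = fun_scale c p" by (simp add: \<epsilon>_def)
  have "f \<epsilon> + f \<delta> = c * f p" using lin sum by metis
  moreover have "ht \<epsilon> + ht \<delta> = c * ht p"
    using ht_add[of \<epsilon> \<delta>] ht_scale[of p c] sum pos_span \<epsilon> \<delta> p by metis
  ultimately have "f p * ht \<epsilon> + f p * ht \<delta> = f \<epsilon> * ht p + f \<delta> * ht p"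
    by (metis distrib_left distrib_right mult.assoc mult.commute)
  with P[OF \<epsilon>] P[OF \<delta>(1,2)] have "f p * ht \<delta> = f \<delta> * ht p" by linarith
  then show False using sep \<delta> by blast
qed

text \<open>A minimiser of the ratio \<open>f / ht\<close> with denominators cleared, as positive
  heights permit.\<close>

lemma extremal_exists:
  assumes "finite R" "R \<noteq> {}" "R \<subseteq> pos"
  obtains p where "p \<in> R" "\<And>\<delta>. \<delta> \<in> R \<Longrightarrow> f p * ht \<delta> \<le> f \<delta> * ht p"
proof -
  obtain p where p: "p \<in> R" "\<And>\<delta>. \<delta> \<in> R \<Longrightarrow> f p / ht p \<le> f \<delta> / ht \<delta>"
    using assms(1,2) arg_min_if_finite[of R "\<lambda>\<delta>. f \<delta> / ht \<delta>"]
    by (metis linorder_not_less)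
  have "f p * ht \<delta> \<le> f \<delta> * ht p" if "\<delta> \<in> R" for \<delta>
  proof -
    have "ht p > 0" "ht \<delta> > 0" using that p(1) assms(3) ht_pos by auto
    then show ?thesis using p(2)[OF that] by (simp add: field_simps)
  qed
  with p(1) that show ?thesis by blast
qed

text \<open>Descending from the lower one of the two roots by the two simple reflections of the plane they
  span stays inside the ideal.\<close>

lemma acute_pair_third_aux:
  assumes \<beta>: "\<beta> \<in> \<Psi>" and \<gamma>: "\<gamma> \<in> \<Psi>" and ne: "\<beta> \<noteq> \<gamma>" and acute: "dot I \<beta> \<gamma> > 0" and ht: "ht \<gamma> \<le> ht \<beta>"
  shows "\<exists>\<psi>\<in>\<Psi>. \<psi> \<noteq> \<beta> \<and> \<psi> \<noteq> \<gamma> \<and> (\<exists>x y. \<psi> = fun_scale x \<beta> + fun_scale y \<gamma>)"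
proof (rule ccontr)
  assume no: "\<not> ?thesis"
  define P where "P = {fun_scale x \<beta> + fun_scale y \<gamma> | x y. True}"
  have only: "\<psi> = \<beta> \<or> \<psi> = \<gamma>" if "\<psi> \<in> \<Psi>" "\<psi> \<in> P" for \<psi>
    using no that unfolding P_def by blast
  have pos: "\<beta> \<in> pos" "\<gamma> \<in> pos" using \<beta> \<gamma> ideal_pos by auto
  note span = pos_span[OF pos(1)] pos_span[OF pos(2)]
  have plane: "fun_scale c v - w \<in> P" if "v \<in> P" "w \<in> P" for c v w
  proof -
    from that obtain x y x' y' where "v = fun_scale x \<beta> + fun_scale y \<gamma>"
      "w = fun_scale x' \<beta> + fun_scale y' \<gamma>" unfolding P_def by blast
    then have "fun_scale c v - w = fun_scale (c * x - x') \<beta> + fun_scale (c * y - y') \<gamma>"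
      by (auto simp: fun_scale_def fun_eq_iff algebra_simps)
    then show ?thesis unfolding P_def by blast
  qed
  have inP: "\<beta> \<in> P" "\<gamma> \<in> P"
    unfolding P_def
    by (rule CollectI, rule exI[of _ 1], rule exI[of _ 0], simp)
      (rule CollectI, rule exI[of _ 0], rule exI[of _ 1], simp)
  \<comment> \<open>A positive multiple of the component of \<beta> orthogonal to \<gamma>. Pairing
    with it gives a functional \<open>f\<close> on the plane that vanishes exactly on the line of
    \<gamma> and is positive at \<beta>.\<close>
  define w where "w = fun_scale (dot I \<gamma> \<gamma>) \<beta> - fun_scale (dot I \<beta> \<gamma>) \<gamma>"
  define f where "f = dot I w"
  have f\<gamma>: "f \<gamma> = 0" by (simp add: f_def w_def dot_linear)
  have "w \<noteq> 0"
  proof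
    assume "w = 0"
    then have "fun_scale (dot I \<gamma> \<gamma>) \<beta> = fun_scale (dot I \<beta> \<gamma>) \<gamma>" by (simp add: w_def)
    then have "\<beta> = fun_scale (dot I \<beta> \<gamma> / dot I \<gamma> \<gamma>) \<gamma>"
      using dot_root_pos[OF pos_root[OF pos(2)]] by (auto simp: fun_scale_def fun_eq_iff field_simps)
    then show False using pos_proportional[OF pos(2,1)] ne by blast
  qed
  moreover have "w \<in> coord_space I"
    unfolding w_def using root_coord_space[OF pos_root] pos
    by (intro coord_space_diff coord_space_scale) auto
  ultimately have "dot I w w > 0" using dot_self_pos finite_index by blast
  moreover have "dot I w w = dot I \<gamma> \<gamma> * f \<beta>"
    using f\<gamma> unfolding f_def by (subst (2) w_def) (simp add: dot_linear)
  ultimately have f\<beta>: "f \<beta> > 0"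
    using dot_root_pos[OF pos_root[OF pos(2)]] by (simp add: zero_less_mult_iff)
  have lin: "f (x + y) = f x + f y" "f (fun_scale c x) = c * f x" for x y c
    by (simp_all add: f_def dot_linear)
  have kernel: "\<exists>y. v = fun_scale y \<gamma>" if "v \<in> P" "f v = 0" for v
    using that f\<beta> f\<gamma> by (auto simp: P_def lin)
  \<comment> \<open>Roots with equal ratios are equal: the combination \<open>v\<close> has
    \<open>f v = 0\<close>, so it is a multiple of \<gamma>, and height zero makes that multiple
    zero. Thus the two positive roots are proportional.\<close>
  have sep: "\<delta> = p" if "\<delta> \<in> pos" "\<delta> \<in> P" "p \<in> pos" "p \<in> P" "f p * ht \<delta> = f \<delta> * ht p" for \<delta> p
  proof -
    define v where "v = fun_scale (ht p) \<delta> - fun_scale (ht \<delta>) p"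
    have "v \<in> P" "f v = 0"
      \<comment> \<open>The closure \<open>plane\<close> only yields differences, so a plain
        multiple of \<open>p\<close> is written as a multiple larger by one, minus
        \<open>p\<close>.\<close>
      using plane[of p p "ht \<delta> + 1"] plane[of \<delta> "fun_scale (ht \<delta>) p" "ht p"] that
      by (simp_all add: v_def fun_space.scale_left_distrib f_def dot_linear algebra_simps)
    then obtain y where y: "v = fun_scale y \<gamma>" using kernel by blast
    have "ht v = 0"
      using that pos_span by (simp add: v_def ht_diff ht_scale fun_space.span_scale)
    then have "y = 0" using y ht_scale[OF span(2), of y] ht_pos[OF pos(2)] by simp
    then have "fun_scale (ht p) \<delta> = fun_scale (ht \<delta>) p" using y by (simp add: v_def)
    then have "\<delta> = fun_scale (ht \<delta> / ht p) p"
      using ht_pos[OF that(3)] by (auto simp: fun_scale_def fun_eq_iff field_simps)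
    then show ?thesis using pos_proportional that by blast
  qed
  define R where "R = pos \<inter> P"
  have R: "finite R" "R \<noteq> {}" "R \<subseteq> pos" using finite_pos pos inP by (auto simp: R_def)
  obtain p where p: "p \<in> R" "\<And>\<delta>. \<delta> \<in> R \<Longrightarrow> f p * ht \<delta> \<le> f \<delta> * ht p"
    using extremal_exists[OF R] by blast
  \<comment> \<open>Minimising for \<open>- f\<close> maximises the ratio, which gives the other
    simple root of the rank two subsystem.\<close>
  obtain q where q: "q \<in> R" "\<And>\<delta>. \<delta> \<in> R \<Longrightarrow> - f q * ht \<delta> \<le> - f \<delta> * ht q"
    using extremal_exists[OF R, of "\<lambda>\<delta>. - f \<delta>"] by blast
  have refl_p: "reflection I p \<delta> \<in> pos" if "\<delta> \<in> R" "\<delta> \<noteq> p" for \<delta>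
    by (rule reflection_extremal[of P f]) (use p sep lin plane that in \<open>auto simp: R_def\<close>)
  have refl_q: "reflection I q \<delta> \<in> pos" if "\<delta> \<in> R" "\<delta> \<noteq> q" for \<delta>
    by (rule reflection_extremal[of P "\<lambda>\<delta>. - f \<delta>"]) (use q sep lin plane that in \<open>auto simp: R_def\<close>)
  \<comment> \<open>A reflection at an acute angle subtracts a positive multiple of a positive root,
    so it stays in the ideal and the plane and strictly lowers the height.\<close>
  have low: "reflection I r \<delta> \<in> \<Psi> \<and> reflection I r \<delta> \<in> P \<and> ht (reflection I r \<delta>) < ht \<delta>"
    if "\<delta> \<in> \<Psi>" "\<delta> \<in> P" "r \<in> R" "reflection I r \<delta> \<in> pos" "dot I r \<delta> > 0" for r \<delta>
  proof -
    define c where "c = 2 * dot I r \<delta> / dot I r r"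
    have r: "r \<in> pos" "r \<in> P" using that by (auto simp: R_def)
    have c: "c > 0" using that(5) dot_root_pos[OF pos_root[OF r(1)]] by (simp add: c_def)
    have eq: "reflection I r \<delta> = \<delta> - fun_scale c r" by (simp add: reflection_def c_def)
    have "fun_scale 0 r - (fun_scale c r - \<delta>) \<in> P" using plane that r by blast
    then have "reflection I r \<delta> \<in> P" unfolding eq by simp
    moreover have "ht (reflection I r \<delta>) < ht \<delta>"
      using c ht_pos[OF r(1)] pos_span[OF r(1)] pos_span[OF ideal_pos[OF that(1)]]
      by (simp add: eq ht_diff ht_scale fun_space.span_scale)
    moreover have "reflection I r \<delta> \<in> \<Psi>" using ideal_reflection that r by simp
    ultimately show ?thesis by blast
  qed
  \<comment> \<open>Otherwise the reflected root would be lower than \<gamma>, but the only ideal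
    roots in the plane are \<gamma> and the no lower \<beta>.\<close>
  have not_acute: "dot I r \<gamma> \<le> 0" if "r \<in> R" "reflection I r \<gamma> \<in> pos" for r
  proof (rule ccontr)
    assume "\<not> ?thesis"
    then have "reflection I r \<gamma> \<in> \<Psi>" "reflection I r \<gamma> \<in> P" "ht (reflection I r \<gamma>) < ht \<gamma>"
      using low[OF \<gamma> inP(2) that] by auto
    then show False using only ht by force
  qed
  show False
  proof (cases "\<gamma> \<in> {p, q}")
    case True
    \<comment> \<open>Here \<gamma> is simple in the plane. Reflecting \<beta> in it must give
      \<gamma>, yet the reflection preserves the value of \<open>f\<close>, which is positive at
      \<beta> and zero at \<gamma>.\<close>
    then have "reflection I \<gamma> \<beta> \<in> pos" using refl_p[of \<beta>] refl_q[of \<beta>] ne pos inP by (auto simp: R_def)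
    then have *: "reflection I \<gamma> \<beta> \<in> \<Psi>" "reflection I \<gamma> \<beta> \<in> P" "ht (reflection I \<gamma> \<beta>) < ht \<beta>"
      using low[OF \<beta> inP(1), of \<gamma>] acute pos inP by (auto simp: R_def dot_commute)
    then have "reflection I \<gamma> \<beta> = \<gamma>" using only by force
    then have "f (reflection I \<gamma> \<beta>) = 0" using f\<gamma> by simp
    then have "f \<beta> = 0" using f\<gamma> by (simp add: reflection_def f_def dot_linear)
    then show False using f\<beta> by simp
  next
    case False
    have \<gamma>R: "\<gamma> \<in> R" using pos inP by (simp add: R_def)
    have pp: "dot I p \<gamma> \<le> 0" and qq: "dot I q \<gamma> \<le> 0"
      using not_acute refl_p refl_q \<gamma>R p(1) q(1) False by auto
    have pR: "p \<in> pos" "p \<in> P" and qR: "q \<in> pos" "q \<in> P" using p q by (auto simp: R_def)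
    \<comment> \<open>Since \<gamma> is neither extremal root, the extremal inequalities are strict,
      and \<open>f \<gamma> = 0\<close> puts \<open>p\<close> and \<open>q\<close> on opposite sides
      of \<gamma>.\<close>
    have "f p * ht \<gamma> \<noteq> f \<gamma> * ht p"
      using sep[OF pos(2) inP(2) pR] False by blast
    then have "f p * ht \<gamma> < f \<gamma> * ht p" using p(2)[OF \<gamma>R] by linarith
    then have "f p * ht \<gamma> < 0" using f\<gamma> by simp
    then have fp: "f p < 0" using ht_pos[OF pos(2)] by (simp add: mult_less_0_iff)
    have "f q * ht \<gamma> \<noteq> f \<gamma> * ht q"
      using sep[OF pos(2) inP(2) qR] False by blast
    then have "f q * ht \<gamma> > f \<gamma> * ht q" using q(2)[OF \<gamma>R] by simp
    then have "f q * ht \<gamma> > 0" using f\<gamma> by simp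
    then have fq: "f q > 0" using ht_pos[OF pos(2)] by (simp add: zero_less_mult_iff)
    \<comment> \<open>The combination of \<open>p\<close> and \<open>q\<close> with positive
      coefficients on which \<open>f\<close> vanishes, hence a multiple of \<gamma>, and a positive
      one by heights. Pairing it with \<gamma> contradicts the two non-acute angles.\<close>
    define v where "v = fun_scale (f q) p - fun_scale (f p) q"
    have "fun_scale (f p + 1) q - q \<in> P" using plane qR by blast
    then have "fun_scale (f p) q \<in> P" by (simp add: fun_space.scale_left_distrib)
    then have "v \<in> P" unfolding v_def using plane pR by blast
    moreover have "f v = 0" by (simp add: v_def f_def dot_linear)
    ultimately obtain y where y: "v = fun_scale y \<gamma>" using kernel by blast
    have "ht v = f q * ht p - f p * ht q"
      using pos_span pR qR by (simp add: v_def ht_diff ht_scale fun_space.span_scale)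
    also have "\<dots> > 0" using fp fq ht_pos[OF pR(1)] ht_pos[OF qR(1)]
      by (smt (verit) mult_pos_pos mult_neg_pos)
    finally have "y > 0" using y ht_scale[OF span(2), of y] ht_pos[OF pos(2)]
      by (simp add: zero_less_mult_iff)
    then have "dot I v \<gamma> > 0" using y dot_root_pos[OF pos_root[OF pos(2)]] by (simp add: dot_linear)
    moreover have "dot I v \<gamma> = f q * dot I p \<gamma> - f p * dot I q \<gamma>" by (simp add: v_def dot_linear)
    moreover have "f q * dot I p \<gamma> \<le> 0" "f p * dot I q \<gamma> \<ge> 0"
      using fp fq pp qq by (simp_all add: mult_le_0_iff zero_le_mult_iff)
    ultimately show False by linarith
  qed
qed

lemma acute_pair_third:
  assumes "\<beta> \<in> \<Psi>" "\<gamma> \<in> \<Psi>" "\<beta> \<noteq> \<gamma>" "dot I \<beta> \<gamma> > 0"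
  shows "\<exists>\<psi>\<in>\<Psi>. \<psi> \<noteq> \<beta> \<and> \<psi> \<noteq> \<gamma> \<and> (\<exists>x y. \<psi> = fun_scale x \<beta> + fun_scale y \<gamma>)"
proof (cases "ht \<gamma> \<le> ht \<beta>")
  case True
  then show ?thesis using acute_pair_third_aux[OF assms] by blast
next
  case False
  then obtain \<psi> x y where "\<psi> \<in> \<Psi>" "\<psi> \<noteq> \<beta>" "\<psi> \<noteq> \<gamma>" "\<psi> = fun_scale x \<gamma> + fun_scale y \<beta>"
    using acute_pair_third_aux[of \<gamma> \<beta>] assms by (auto simp: dot_commute)
  then show ?thesis by (metis add.commute)
qed

text \<open>Separating positive and negative coefficients writes one vector \<open>v\<close> in two
  ways with disjoint supports. The angles give \<open>dot I v v \<le> 0\<close>, so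
  \<open>v = 0\<close>. A vanishing nonnegative combination of positive roots is trivial, as its
  height shows.\<close>

lemma obtuse_independent:
  assumes S: "finite S" "S \<subseteq> pos"
    and obtuse: "\<And>\<beta> \<gamma>. \<beta> \<in> S \<Longrightarrow> \<gamma> \<in> S \<Longrightarrow> \<beta> \<noteq> \<gamma> \<Longrightarrow> dot I \<beta> \<gamma> \<le> 0"
    and rel: "(\<Sum>\<beta>\<in>S. fun_scale (c \<beta>) \<beta>) = 0" and "\<beta> \<in> S"
  shows "c \<beta> = 0"
proof -
  define a where "a \<beta> = max (c \<beta>) 0" for \<beta>
  define b where "b \<beta> = max (- c \<beta>) 0" for \<beta>
  have ab: "a \<beta> \<ge> 0" "b \<beta> \<ge> 0" "a \<beta> * b \<beta> = 0" "c \<beta> = a \<beta> - b \<beta>" for \<beta>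
    by (auto simp: a_def b_def max_def)
  define v where "v = (\<Sum>\<beta>\<in>S. fun_scale (a \<beta>) \<beta>)"
  have "(\<Sum>\<beta>\<in>S. fun_scale (a \<beta>) \<beta>) - (\<Sum>\<beta>\<in>S. fun_scale (b \<beta>) \<beta>) = (\<Sum>\<beta>\<in>S. fun_scale (c \<beta>) \<beta>)"
    by (simp only: sum_subtractf[symmetric] ab(4) fun_space.scale_left_diff_distrib)
  then have v: "v = (\<Sum>\<beta>\<in>S. fun_scale (b \<beta>) \<beta>)" using rel by (simp add: v_def)
  have "dot I v v = dot I (\<Sum>\<beta>\<in>S. fun_scale (a \<beta>) \<beta>) (\<Sum>\<gamma>\<in>S. fun_scale (b \<gamma>) \<gamma>)"
    using v v_def by simp
  also have "\<dots> = (\<Sum>\<beta>\<in>S. \<Sum>\<gamma>\<in>S. a \<beta> * (b \<gamma> * dot I \<beta> \<gamma>))"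
    by (simp only: dot_sum_left dot_scale_left)
      (simp only: dot_sum_right dot_scale_right sum_distrib_left)
  also have "\<dots> \<le> 0"
  proof (intro sum_nonpos)
    fix \<beta> \<gamma> assume "\<beta> \<in> S" "\<gamma> \<in> S"
    show "a \<beta> * (b \<gamma> * dot I \<beta> \<gamma>) \<le> 0"
    proof (cases "\<beta> = \<gamma>")
      case True
      then show ?thesis using ab(3)[of \<beta>] by auto
    next
      case False
      then show ?thesis using obtuse[OF \<open>\<beta> \<in> S\<close> \<open>\<gamma> \<in> S\<close>] ab(1)[of \<beta>] ab(2)[of \<gamma>]
        by (simp add: mult_nonneg_nonpos)
    qed
  qed
  finally have "\<not> dot I v v > 0" by simp
  moreover have "v \<in> coord_space I"
    unfolding v_def using S pos_root root_coord_space
    by (intro coord_space_sum coord_space_scale) auto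
  ultimately have v0: "v = 0" using dot_self_pos finite_index by blast
  have ht_sum: "ht (\<Sum>\<beta>\<in>T. fun_scale (d \<beta>) \<beta>) = (\<Sum>\<beta>\<in>T. d \<beta> * ht \<beta>)"
    if "finite T" "T \<subseteq> pos" for d T
    using that
  proof (induction T)
    case empty
    show ?case by (simp only: sum.empty ht_zero)
  next
    case (insert x F)
    have "(\<Sum>\<beta>\<in>F. fun_scale (d \<beta>) \<beta>) \<in> fun_space.span \<Delta>"
      using insert pos_span by (intro fun_space.span_sum fun_space.span_scale) auto
    moreover have x: "x \<in> fun_space.span \<Delta>" using insert pos_span[of x] by simp
    ultimately have eq: "ht (fun_scale (d x) x + (\<Sum>\<beta>\<in>F. fun_scale (d \<beta>) \<beta>)) =
        d x * ht x + ht (\<Sum>\<beta>\<in>F. fun_scale (d \<beta>) \<beta>)"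
      by (simp only: ht_add ht_scale fun_space.span_scale)
    have "ht (\<Sum>\<beta>\<in>F. fun_scale (d \<beta>) \<beta>) = (\<Sum>\<beta>\<in>F. d \<beta> * ht \<beta>)" using insert by simp
    then show ?case unfolding sum.insert[OF insert.hyps(1,2)] by (simp only: eq)
  qed
  have zero: "d \<beta> = 0" if d: "\<And>\<beta>. d \<beta> \<ge> 0" "(\<Sum>\<beta>\<in>S. fun_scale (d \<beta>) \<beta>) = 0" for d
  proof -
    have "(\<Sum>\<beta>\<in>S. d \<beta> * ht \<beta>) = 0" using ht_sum[OF S, of d] d(2) ht_zero by simp
    then have "\<forall>\<beta>\<in>S. d \<beta> * ht \<beta> = 0"
      using S d(1) ht_pos by (subst (asm) sum_nonneg_eq_0_iff) (auto simp: less_imp_le subset_iff)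
    then show ?thesis using \<open>\<beta> \<in> S\<close> S ht_pos by force
  qed
  have "a \<beta> = 0" "b \<beta> = 0" using zero ab(1,2) v v_def v0 by metis+
  then show ?thesis using ab(4) by simp
qed

end

lemma ideal_no_wheel:
  assumes "ideal_arrangement I A"
  shows "\<not> wheel_pattern I A s r"
proof
  assume w: "wheel_pattern I A s r"
  from assms obtain \<Phi> \<Delta> \<Psi> where roots: "root_system I \<Phi>" "simple_system \<Phi> \<Delta>" "root_ideal \<Phi> \<Delta> \<Psi>"
    and A: "A = hyperplane I ` \<Psi>"
    unfolding ideal_arrangement_def by blast
  interpret root_ideal_setting I \<Phi> \<Delta> \<Psi> by (rule root_ideal_setting.intro[OF roots])
  have normal: "normal_vector I (hyperplane I \<psi>) \<psi>" if "\<psi> \<in> \<Psi>" for \<psi>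
    using ideal_pos[OF that] pos_root root_coord_space root_neq_zero by (auto simp: normal_vector_def)
  have inj: "\<psi> = \<psi>'" if eq: "\<psi> \<in> \<Psi>" "\<psi>' \<in> \<Psi>" "hyperplane I \<psi> = hyperplane I \<psi>'" for \<psi> \<psi>'
  proof -
    obtain c where "\<psi>' = fun_scale c \<psi>"
      using normal_vector_unique[OF finite_index normal[OF eq(1)], of \<psi>'] normal[OF eq(2)] eq(3)
      by auto
    then show ?thesis using pos_proportional[of \<psi> \<psi>' c] ideal_pos eq by simp
  qed
  \<comment> \<open>The root of the ideal defining a hyperplane; it is unique because proportional
    positive roots coincide.\<close>
  define \<rho> where "\<rho> H = (THE \<psi>. \<psi> \<in> \<Psi> \<and> hyperplane I \<psi> = H)" for H
  have \<rho>: "\<rho> H \<in> \<Psi>" "hyperplane I (\<rho> H) = H" if "H \<in> A" for H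
  proof -
    have "\<exists>!\<psi>. \<psi> \<in> \<Psi> \<and> hyperplane I \<psi> = H" using that inj unfolding A by blast
    from theI'[OF this] show "\<rho> H \<in> \<Psi>" "hyperplane I (\<rho> H) = H" by (simp_all add: \<rho>_def)
  qed
  have normal_\<rho>: "normal_vector I H (\<rho> H)" if "H \<in> A" for H
    using normal[of "\<rho> H"] \<rho>[OF that] by simp
  \<comment> \<open>At an acute angle, \<open>acute_pair_third\<close> would supply a third element
    of the arrangement on the line.\<close>
  have obtuse: "dot I (\<rho> H) (\<rho> K) \<le> 0" if "two_point_line I A H K" for H K
  proof (rule ccontr)
    assume acute: "\<not> ?thesis"
    have HK: "H \<in> A" "K \<in> A" "H \<noteq> K" using that by (auto simp: two_point_line_def)
    then have "\<rho> H \<noteq> \<rho> K" using \<rho> by metis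
    then obtain \<psi> x y where \<psi>: "\<psi> \<in> \<Psi>" "\<psi> \<noteq> \<rho> H" "\<psi> \<noteq> \<rho> K" "\<psi> = fun_scale x (\<rho> H) + fun_scale y (\<rho> K)"
      using acute_pair_third[of "\<rho> H" "\<rho> K"] acute \<rho> HK by auto
    define L where "L = hyperplane I \<psi>"
    have L: "L \<in> A" "\<rho> L = \<psi>" using \<psi>(1) \<rho>[of L] inj by (auto simp: L_def A)
    then have LHK: "L \<noteq> H" "L \<noteq> K" using \<psi> by auto
    have "\<not> arr_indep I {H, K, L}"
    proof (rule arr_dependent[OF finite_index, of _ \<rho> "\<lambda>M. if M = H then x else if M = K then y else - 1" L])
      show "(\<Sum>M\<in>{H, K, L}. fun_scale (if M = H then x else if M = K then y else - 1) (\<rho> M)) = 0"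
        using HK LHK by (simp add: L(2)) (simp add: \<psi>(4) fun_space.scale_minus_left)
    qed (use HK LHK L normal_\<rho> in auto)
    then show False using that L LHK by (auto simp: two_point_line_def)
  qed
  define S where "S = {r 0, r 1, r 2, r 3}"
  have rA: "S \<subseteq> A" using w by (auto simp: S_def wheel_pattern_def)
  have sym: "two_point_line I A K H" if "two_point_line I A H K" for H K
    using that by (auto simp: two_point_line_def insert_commute)
  have adj: "two_point_line I A (r i) (r ((i + 3) mod 4))" if "i < 4" for i
    using w that by (auto simp: wheel_pattern_def Let_def)
  have "two_point_line I A (r 0) (r 3)" "two_point_line I A (r 1) (r 0)"
    "two_point_line I A (r 2) (r 1)" "two_point_line I A (r 3) (r 2)"
    "two_point_line I A (r 0) (r 2)" "two_point_line I A (r 1) (r 3)"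
    using adj[of 0] adj[of 1] adj[of 2] adj[of 3] w by (auto simp: wheel_pattern_def)
  \<comment> \<open>The adjacent and the opposite pairs together are all six pairs of rim
    edges.\<close>
  then have lines: "two_point_line I A H K" if "H \<in> S" "K \<in> S" "H \<noteq> K" for H K
    using that sym unfolding S_def by blast
  have inj\<rho>: "inj_on \<rho> S" using \<rho>(2) rA by (metis inj_onI subsetD)
  have "arr_indep I S"
  proof (subst arr_indep_iff[OF finite_index, of _ \<rho>])
    show "finite S" by (simp add: S_def)
    show "normal_vector I H (\<rho> H)" if "H \<in> S" for H using that rA normal_\<rho> by blast
    show "\<forall>c. (\<Sum>H\<in>S. fun_scale (c H) (\<rho> H)) = 0 \<longrightarrow> (\<forall>H\<in>S. c H = 0)"
    proof (intro allI impI ballI)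
      fix c H assume c: "(\<Sum>H\<in>S. fun_scale (c H) (\<rho> H)) = 0" and H: "H \<in> S"
      \<comment> \<open>The coefficients moved from hyperplanes to their roots, where
        \<open>obtuse_independent\<close> applies.\<close>
      define d where "d = c \<circ> inv_into S \<rho>"
      have d: "d (\<rho> K) = c K" if "K \<in> S" for K using that inj\<rho> by (simp add: d_def)
      have "d (\<rho> H) = 0"
      proof (rule obtuse_independent[of "\<rho> ` S" d "\<rho> H"])
        show "\<rho> ` S \<subseteq> pos" using rA \<rho>(1) ideal_pos by auto
        show "dot I \<beta> \<gamma> \<le> 0" if "\<beta> \<in> \<rho> ` S" "\<gamma> \<in> \<rho> ` S" "\<beta> \<noteq> \<gamma>" for \<beta> \<gamma>
          using that obtuse lines by auto
        show "(\<Sum>\<beta>\<in>\<rho> ` S. fun_scale (d \<beta>) \<beta>) = 0"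
          using c by (simp add: sum.reindex[OF inj\<rho>] d)
      qed (use H in \<open>auto simp: S_def\<close>)
      then show "c H = 0" using d H by simp
    qed
  qed
  then show False using w by (simp add: wheel_pattern_def S_def)
qed

section \<open>Patterns in the Dirichlet arrangement\<close>

text \<open>\<open>Some\<close> embeds the interior vertices among the coordinates, so the facts on
  edge hyperplanes apply to interior edges.\<close>

abbreviation inner_hyp :: "'v set \<Rightarrow> 'v set \<Rightarrow> 'v set \<Rightarrow> ('v option \<Rightarrow> 'k::field) set" where
  "inner_hyp V B e \<equiv> edge_hyp (dirichlet_index V B) (Some ` e)"

section \<open>Normals and case analysis for the Dirichlet arrangement\<close>

lemma finite_dirichlet_index: "finite V \<Longrightarrow> finite (dirichlet_index V B)"
  by (simp add: dirichlet_index_def)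

lemma normal_vector_None:
  assumes "finite V"
  shows "normal_vector (dirichlet_index V B) {x \<in> coord_space (dirichlet_index V B). x None = 0}
    (unit_vec None :: _ \<Rightarrow> 'k::field)"
proof -
  have "None \<in> dirichlet_index V B" by (simp add: dirichlet_index_def)
  moreover have "(unit_vec None :: _ \<Rightarrow> 'k) \<noteq> 0" by (auto simp: unit_vec_def fun_eq_iff)
  ultimately show ?thesis
    using finite_dirichlet_index[OF assms, of B]
    by (simp add: normal_vector_def hyperplane_def dot_unit_vec unit_vec_coord_space)
qed

lemma normal_vector_boundary:
  assumes "finite V" "i \<in> V - B"
  shows "normal_vector (dirichlet_index V B)
    {x \<in> coord_space (dirichlet_index V B). x (Some i) = t * x None}
    (unit_vec (Some i) - fun_scale t (unit_vec None) :: _ \<Rightarrow> 'k::field)"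
proof -
  have I: "None \<in> dirichlet_index V B" "Some i \<in> dirichlet_index V B"
    using assms by (auto simp: dirichlet_index_def)
  have "(unit_vec (Some i) - fun_scale t (unit_vec None) :: _ \<Rightarrow> 'k) (Some i) = 1"
    by (simp add: unit_vec_def fun_scale_def)
  then have "(unit_vec (Some i) - fun_scale t (unit_vec None) :: _ \<Rightarrow> 'k) \<noteq> 0"
    by (metis zero_fun_apply zero_neq_one)
  then show ?thesis
    using I finite_dirichlet_index[OF assms(1), of B]
    by (simp add: normal_vector_def hyperplane_def dot_diff_left dot_scale_left dot_unit_vec
        coord_space_diff coord_space_scale unit_vec_coord_space)
qed

context
  fixes V :: "'v set" and E :: "'v set set" and B :: "'v set" and u :: "'v \<Rightarrow> 'k::field"
  assumes graph: "simple_graph V E" and nonadj: "\<forall>i\<in>B. \<forall>j\<in>B. {i, j} \<notin> E"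
begin

lemma finite_verts: "finite V"
  using graph by (simp add: simple_graph_def)

lemma inner_edge: "e \<in> delete_verts_edges E B \<Longrightarrow> e \<subseteq> V - B \<and> card e = 2"
  using graph by (auto simp: simple_graph_def delete_verts_edges_def)

lemma inner_edge_index:
  assumes "e \<in> delete_verts_edges E B"
  shows "Some ` e \<subseteq> dirichlet_index V B" "card (Some ` e) = 2"
  using inner_edge[OF assms] by (auto simp: dirichlet_index_def card_image)

lemma inner_hyp_in:
  assumes "e \<in> delete_verts_edges E B"
  shows "inner_hyp V B e \<in> dirichlet_arrangement V E B u"
proof -
  obtain i j where "e = {i, j}" using inner_edge[OF assms] by (auto simp: card_2_iff)
  then show ?thesis
    using assms unfolding dirichlet_arrangement_def delete_verts_edges_def
    by (auto simp: edge_hyp_pair)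
qed

lemma inner_hyp_inject:
  assumes "e \<in> delete_verts_edges E B" "e' \<in> delete_verts_edges E B"
  shows "inner_hyp V B e = (inner_hyp V B e' :: ('v option \<Rightarrow> 'k) set) \<longleftrightarrow> e = e'"
  using edge_hyp_inject[of "Some ` e" "dirichlet_index V B" "Some ` e'"]
    inner_edge_index[OF assms(1)] inner_edge_index[OF assms(2)]
  by (simp add: inj_image_eq_iff)

text \<open>Nonadjacency of boundary nodes makes the other endpoint of a boundary edge interior. The
  potential \<open>u j\<close> is abstracted to \<open>t\<close>, as its value is irrelevant for the
  tests below.\<close>

lemma dirichlet_arrangement_cases:
  assumes "L \<in> dirichlet_arrangement V E B u"
  obtains (inner) e where "e \<in> delete_verts_edges E B" "L = inner_hyp V B e"
  | (boundary) i t where "i \<in> V - B" "L = {x \<in> coord_space (dirichlet_index V B). x (Some i) = t * x None}"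
  | (infinity) "L = {x \<in> coord_space (dirichlet_index V B). x None = 0}"
proof -
  from assms consider
    (a) i j where "{i, j} \<in> E" "i \<notin> B" "j \<notin> B"
      "L = {x \<in> coord_space (dirichlet_index V B). x (Some i) = x (Some j)}"
  | (b) i j where "{i, j} \<in> E" "j \<in> B"
      "L = {x \<in> coord_space (dirichlet_index V B). x (Some i) = u j * x None}"
  | (c) "L = {x \<in> coord_space (dirichlet_index V B). x None = 0}"
    unfolding dirichlet_arrangement_def by blast
  then show ?thesis
  proof cases
    case (a i j)
    then show ?thesis using inner[of "{i, j}"] by (simp add: edge_hyp_pair delete_verts_edges_def)
  next
    case (b i j)
    then have "i \<notin> B" using nonadj by blast
    moreover have "i \<in> V" using b(1) graph by (auto simp: simple_graph_def)
    ultimately show ?thesis using boundary[of i "u j"] b(3) by blast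
  next
    case c
    then show ?thesis by (rule infinity)
  qed
qed

text \<open>A third interior edge on the line could only be the symmetric difference. The remaining
  hyperplanes are excluded by test points on which all interior coordinates agree.\<close>

lemma inner_two_point_line:
  assumes e: "e \<in> delete_verts_edges E B" and e': "e' \<in> delete_verts_edges E B" and "e \<noteq> e'"
    and no_triangle: "(e \<union> e') - (e \<inter> e') \<notin> delete_verts_edges E B"
  shows "two_point_line (dirichlet_index V B) (dirichlet_arrangement V E B u)
    (inner_hyp V B e) (inner_hyp V B e')"
proof -
  let ?I = "dirichlet_index V B" and ?h = "inner_hyp V B :: _ \<Rightarrow> ('v option \<Rightarrow> 'k) set"
  note fin = finite_dirichlet_index[OF finite_verts, of B]
  obtain a a' where n: "normal_vector ?I (?h e) a" "normal_vector ?I (?h e') a'"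
    using normal_edge_hyp_ex[OF fin] inner_edge_index[OF e] inner_edge_index[OF e'] by metis
  have ne: "?h e \<noteq> ?h e'" using inner_hyp_inject[OF e e'] \<open>e \<noteq> e'\<close> by simp
  have "arr_indep ?I {?h e, ?h e', L}"
    if L: "L \<in> dirichlet_arrangement V E B u" "L \<noteq> ?h e" "L \<noteq> ?h e'" for L
    using L(1)
  proof (cases rule: dirichlet_arrangement_cases)
    case (inner d)
    have "d \<noteq> (e \<union> e') - (e \<inter> e')" using inner(1) no_triangle by blast
    then have "Some ` d \<noteq> (Some ` e \<union> Some ` e') - (Some ` e \<inter> Some ` e')"
      by (simp add: image_Un[symmetric] image_Int[symmetric] image_set_diff[symmetric] inj_image_eq_iff)
    moreover have "d \<noteq> e" "d \<noteq> e'" using inner(2) L by auto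
    ultimately show ?thesis
      unfolding inner(2)
      using inner_edge_index[OF e] inner_edge_index[OF e'] inner_edge_index[OF inner(1)] \<open>e \<noteq> e'\<close>
      by (intro edge_triple_indep[OF fin]) (simp_all add: inj_image_eq_iff)
  next
    case (boundary i t)
    \<comment> \<open>The test point is 1 on interior coordinates and 0 at \<open>None\<close>, so
      it violates the boundary equation for every \<open>t\<close>.\<close>
    have T: "Some ` (V - B) \<subseteq> ?I" by (auto simp: dirichlet_index_def)
    show ?thesis
    proof (rule arr_indep_triple[OF fin n _ ne, where x = "ind_vec (Some ` (V - B))"])
      show "normal_vector ?I L (unit_vec (Some i) - fun_scale t (unit_vec None))"
        unfolding boundary(2) using normal_vector_boundary[OF finite_verts boundary(1)] .
      show "ind_vec (Some ` (V - B)) \<notin> L" using boundary by (auto simp: ind_vec_def)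
    qed (use inner_edge[OF e] inner_edge[OF e'] in \<open>auto simp: ind_vec_edge_hyp[OF T]\<close>)
  next
    case infinity
    \<comment> \<open>The test point is 1 at \<open>None\<close> and 0 elsewhere.\<close>
    have T: "{None} \<subseteq> ?I" by (auto simp: dirichlet_index_def)
    show ?thesis
    proof (rule arr_indep_triple[OF fin n _ ne, where x = "ind_vec {None}"])
      show "normal_vector ?I L (unit_vec None)"
        unfolding infinity using normal_vector_None[OF finite_verts] .
      show "ind_vec {None} \<notin> L" using infinity by (auto simp: ind_vec_def)
    qed (auto simp: ind_vec_edge_hyp[OF T])
  qed
  then show ?thesis
    unfolding two_point_line_def using inner_hyp_in[OF e] inner_hyp_in[OF e'] ne by blast
qed

text \<open>The symmetric difference of disjoint edges has four vertices and is therefore no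
  edge.\<close>

lemma inner_two_point_line_disjoint:
  assumes "e \<in> delete_verts_edges E B" "e' \<in> delete_verts_edges E B" "e \<inter> e' = {}"
  shows "two_point_line (dirichlet_index V B) (dirichlet_arrangement V E B u)
    (inner_hyp V B e) (inner_hyp V B e')"
proof -
  have e: "card e = 2" "card e' = 2" "finite e" "finite e'"
    using inner_edge assms finite_verts by (auto intro: finite_subset)
  then have "card ((e \<union> e') - (e \<inter> e')) = 4" using assms(3) by (simp add: card_Un_disjoint)
  then have "(e \<union> e') - (e \<inter> e') \<notin> delete_verts_edges E B" using inner_edge by force
  moreover have "e \<noteq> e'" using e assms(3) by auto
  ultimately show ?thesis using inner_two_point_line assms by blast
qed

text \<open>The vertex \<open>f 4\<close> is the hub. That the wheel is induced enters through the
  missing chords of the rim: a chord would be the third side for two consecutive-but-one spokes or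
  for two consecutive rim edges.\<close>

lemma dirichlet_wheel:
  assumes "contains_induced (V - B) (delete_verts_edges E B) wheel5_verts wheel5_edges"
  shows "\<exists>s r. wheel_pattern (dirichlet_index V B) (dirichlet_arrangement V E B u) s r"
proof -
  let ?D = "delete_verts_edges E B" and ?h = "inner_hyp V B :: _ \<Rightarrow> ('v option \<Rightarrow> 'k) set"
  let ?I = "dirichlet_index V B" and ?A = "dirichlet_arrangement V E B u"
  obtain f where f: "inj_on f wheel5_verts" "f ` wheel5_verts \<subseteq> V - B"
    "\<forall>i\<in>wheel5_verts. \<forall>j\<in>wheel5_verts. {i, j} \<in> wheel5_edges \<longleftrightarrow> {f i, f j} \<in> ?D"
    using assms unfolding contains_induced_def by (elim exE conjE)
  have verts: "i \<in> wheel5_verts" if "i < 5" for i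
    using that unfolding wheel5_verts_def insert_iff empty_iff by presburger
  have edge: "{f i, f j} \<in> ?D \<longleftrightarrow> {i, j} \<in> wheel5_edges" if "i < 5" "j < 5" for i j
    using f(3) verts that by simp
  have f_eq: "f i = f j \<longleftrightarrow> i = j" if "i < 5" "j < 5" for i j
    using f(1) verts that by (auto simp: inj_on_def)
  have fV: "Some (f i) \<in> ?I" if "i < 5" for i
    using f(2) verts[OF that] by (auto simp: dirichlet_index_def)
  define s where "s i = ?h {f 4, f i}" for i
  define r where "r i = ?h {f i, f ((i + 1) mod 4)}" for i
  have tri: "\<not> arr_indep ?I {?h {a, b}, ?h {b, c}, ?h {a, c}}"
    if "distinct [a, b, c]" "Some a \<in> ?I" "Some b \<in> ?I" "Some c \<in> ?I" for a b c
    using triangle_dependent[OF finite_dirichlet_index[OF finite_verts], of "Some a" "Some b" "Some c" B] that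
    by simp
  have main: "s i \<in> ?A \<and> r i \<in> ?A \<and> distinct [s i, s j, r i] \<and> \<not> arr_indep ?I {s i, s j, r i} \<and>
      two_point_line ?I ?A (s j) (s k) \<and> two_point_line ?I ?A (s j) (r k) \<and>
      two_point_line ?I ?A (r i) (s k) \<and> two_point_line ?I ?A (r i) (r k)"
    if i: "i < 4" and j: "j = (i + 1) mod 4" and k: "k = (i + 3) mod 4" for i j k
  proof -
    have lt: "i < 5" "j < 5" "k < 5" "(4::nat) < 5" using i j k by auto
    have "i = 0 \<or> i = 1 \<or> i = 2 \<or> i = 3" using i by presburger
    then have cases: "(i, j, k) \<in> {(0, 1, 3), (1, 2, 0), (2, 3, 1), (3, 0, 2)}"
      unfolding j k by (elim disjE) simp_all
    have dist: "distinct [i, j, k, 4]" using cases by auto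
    have W: "{4, i} \<in> wheel5_edges" "{4, j} \<in> wheel5_edges" "{4, k} \<in> wheel5_edges"
      "{i, j} \<in> wheel5_edges" "{k, i} \<in> wheel5_edges" "{j, k} \<notin> wheel5_edges"
      using cases by (auto simp: wheel5_edges_def doubleton_eq_iff)
    \<comment> \<open>The vertex at \<open>i\<close>, its successor, its predecessor and the hub;
      the missing chord is \<open>{b, c}\<close>.\<close>
    define a b c h where "a = f i" "b = f j" "c = f k" "h = f 4"
    note abch = this
    have D: "{h, a} \<in> ?D" "{h, b} \<in> ?D" "{h, c} \<in> ?D" "{a, b} \<in> ?D" "{c, a} \<in> ?D" "{b, c} \<notin> ?D"
      using W lt unfolding abch by (simp_all only: edge simp_thms)
    have ne: "distinct [a, b, c, h]" using dist f_eq lt unfolding abch by simp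
    have ki: "(k + 1) mod 4 = i" using cases by auto
    have sr: "s i = ?h {h, a}" "s j = ?h {h, b}" "s k = ?h {h, c}" "r i = ?h {a, b}" "r k = ?h {c, a}"
      using ki j by (simp_all add: s_def r_def abch)
    have "s i \<in> ?A" "r i \<in> ?A" unfolding sr using D by (simp_all only: inner_hyp_in)
    moreover have "distinct [s i, s j, r i]"
      unfolding sr using ne by (auto simp only: inner_hyp_inject D distinct.simps list.set doubleton_eq_iff)
    moreover have "\<not> arr_indep ?I {s i, s j, r i}"
    proof -
      have "\<not> arr_indep ?I {?h {a, h}, ?h {h, b}, ?h {a, b}}"
      proof (rule tri)
        show "distinct [a, h, b]" using ne by auto
      qed (simp_all add: abch fV lt)
      then show ?thesis unfolding sr by (simp add: insert_commute)
    qed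
    moreover have "two_point_line ?I ?A (s j) (s k)" unfolding sr
    proof (rule inner_two_point_line[OF D(2,3)])
      have "({h, b} \<union> {h, c}) - ({h, b} \<inter> {h, c}) = {b, c}" using ne by auto
      then show "({h, b} \<union> {h, c}) - ({h, b} \<inter> {h, c}) \<notin> ?D" using D(6) by simp
    qed (use ne in \<open>auto simp: doubleton_eq_iff\<close>)
    moreover have "two_point_line ?I ?A (s j) (r k)" unfolding sr
      by (rule inner_two_point_line_disjoint[OF D(2,5)]) (use ne in auto)
    moreover have "two_point_line ?I ?A (r i) (s k)" unfolding sr
      by (rule inner_two_point_line_disjoint[OF D(4,3)]) (use ne in auto)
    moreover have "two_point_line ?I ?A (r i) (r k)" unfolding sr
    proof (rule inner_two_point_line[OF D(4,5)])
      have "({a, b} \<union> {c, a}) - ({a, b} \<inter> {c, a}) = {b, c}" using ne by auto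
      then show "({a, b} \<union> {c, a}) - ({a, b} \<inter> {c, a}) \<notin> ?D" using D(6) by simp
    qed (use ne in \<open>auto simp: doubleton_eq_iff\<close>)
    ultimately show ?thesis by blast
  qed
  have rim: "{f 0, f 1} \<in> ?D" "{f 1, f 2} \<in> ?D" "{f 2, f 3} \<in> ?D" "{f 3, f 0} \<in> ?D"
    by (simp_all add: edge wheel5_edges_def)
  have "(0 + 1) mod 4 = (1::nat)" "(1 + 1) mod 4 = (2::nat)" "(2 + 1) mod 4 = (3::nat)"
    "(3 + 1) mod 4 = (0::nat)" by simp_all
  then have r: "r 0 = ?h {f 0, f 1}" "r 1 = ?h {f 1, f 2}" "r 2 = ?h {f 2, f 3}" "r 3 = ?h {f 3, f 0}"
    by (simp_all only: r_def)
  have opp: "two_point_line ?I ?A (r 0) (r 2)" "two_point_line ?I ?A (r 1) (r 3)"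
    unfolding r by (rule inner_two_point_line_disjoint; use rim in \<open>simp add: f_eq\<close>)+
  have "\<not> arr_indep ?I {r 0, r 1, r 2, r 3}"
    using quadrangle_dependent[OF finite_dirichlet_index[OF finite_verts],
        of "Some (f 0)" "Some (f 1)" "Some (f 2)" "Some (f 3)" B]
    unfolding r by (simp add: f_eq fV insert_commute)
  then have "wheel_pattern ?I ?A s r"
    unfolding wheel_pattern_def Let_def using main opp by blast
  then show ?thesis by blast
qed

text \<open>The normals of the boundary hyperplanes at \<open>v\<close> and of the hyperplane at
  infinity all lie in the plane spanned by two unit vectors, and injectivity of \<open>u\<close>
  keeps them pairwise non-proportional.\<close>

lemma dirichlet_four_point_line:
  assumes u: "inj_on u B" and "\<exists>v\<in>V. card {b \<in> B. {v, b} \<in> E} \<ge> 3"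
  shows "four_point_line (dirichlet_index V B) (dirichlet_arrangement V E B u)"
proof -
  let ?I = "dirichlet_index V B"
  note fin = finite_dirichlet_index[OF finite_verts, of B]
  from assms(2) obtain v where v: "v \<in> V" "card {b \<in> B. {v, b} \<in> E} \<ge> 3" by blast
  obtain N where N: "N \<subseteq> {b \<in> B. {v, b} \<in> E}" "card N = 3"
    using obtain_subset_with_card_n[OF v(2)] by blast
  have finN: "finite N" using N(2) by (intro card_ge_0_finite) simp
  have NB: "b \<in> B" "{v, b} \<in> E" if "b \<in> N" for b using N that by auto
  \<comment> \<open>A boundary node has no boundary neighbours, so \<open>v\<close> is
    interior.\<close>
  have vB: "v \<in> V - B" using NB N(2) nonadj v(1) by force
  \<comment> \<open>Together \<open>p\<close> and \<open>q\<close> give the normals in the plane: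
    \<open>None\<close> stands for the hyperplane at infinity, \<open>Some b\<close> for the edge
    from \<open>v\<close> to \<open>b\<close>.\<close>
  define p :: "'v option \<Rightarrow> 'k" where "p x = (case x of None \<Rightarrow> 0 | Some b \<Rightarrow> 1)" for x
  define q :: "'v option \<Rightarrow> 'k" where "q x = (case x of None \<Rightarrow> 1 | Some b \<Rightarrow> - u b)" for x
  define n where "n x = fun_scale (p x) (unit_vec (Some v)) + fun_scale (q x) (unit_vec None)" for x
  define g where "g x = hyperplane ?I (n x)" for x
  define Q where "Q = insert None (Some ` N)"
  have I: "None \<in> ?I" "Some v \<in> ?I" using vB by (auto simp: dirichlet_index_def)
  \<comment> \<open>The determinant of two of these normals: 1 or -1 if one index is
    \<open>None\<close>, and a difference of values of \<open>u\<close> otherwise.\<close>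
  have cross: "p x * q y - p y * q x \<noteq> 0" if "x \<in> Q" "y \<in> Q" "x \<noteq> y" for x y
    using that NB inj_onD[OF u] by (auto simp: Q_def p_def q_def)
  have dot_n: "dot ?I (n x) y = p x * y (Some v) + q x * y None" for x y
    using I fin by (simp add: n_def dot_linear dot_unit_vec)
  have normal: "normal_vector ?I (g x) (n x)" for x
  proof -
    have "n x \<noteq> 0"
    proof
      assume "n x = 0"
      then have "n x (Some v) = 0" "n x None = 0" by simp_all
      then show False by (cases x) (simp_all add: n_def p_def q_def fun_scale_def unit_vec_def)
    qed
    moreover have "n x \<in> coord_space ?I"
      unfolding n_def using I by (intro coord_space_add coord_space_scale unit_vec_coord_space)
    ultimately show ?thesis by (simp add: normal_vector_def g_def)
  qed
  have gA: "g x \<in> dirichlet_arrangement V E B u" if "x \<in> Q" for x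
  proof (cases x)
    case None
    then show ?thesis
      by (simp add: g_def hyperplane_def dot_n p_def q_def dirichlet_arrangement_def)
  next
    case (Some b)
    then have b: "b \<in> N" using that by (auto simp: Q_def)
    have "g x = {y \<in> coord_space ?I. y (Some v) = u b * y None}"
      using Some by (simp add: g_def hyperplane_def dot_n p_def q_def)
    then show ?thesis unfolding dirichlet_arrangement_def using NB[OF b] by blast
  qed
  have g_ne: "g x \<noteq> g y" if "x \<in> Q" "y \<in> Q" "x \<noteq> y" for x y
  proof
    assume eq: "g x = g y"
    \<comment> \<open>A vector on \<open>g x\<close> whose pairing with the normal of
      \<open>g y\<close> is, up to sign, the determinant in \<open>cross\<close>.\<close>
    define w where "w = fun_scale (q x) (unit_vec (Some v)) - fun_scale (p x) (unit_vec None)"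
    have w: "w (Some v) = q x" "w None = - p x" by (simp_all add: w_def fun_scale_def unit_vec_def)
    have "w \<in> coord_space ?I"
      unfolding w_def using I by (intro coord_space_diff coord_space_scale unit_vec_coord_space)
    moreover have "dot ?I (n x) w = 0" by (simp add: dot_n w)
    ultimately have "w \<in> g y" unfolding eq[symmetric] by (simp add: g_def hyperplane_def)
    then have "p y * q x - q y * p x = 0" by (simp add: g_def hyperplane_def dot_n w)
    then show False using cross[OF that] by (simp add: algebra_simps)
  qed
  have injg: "inj_on g Q" using g_ne by (meson inj_onI)
  have cardO: "card Q = 4" using N(2) finN by (simp add: Q_def card_image)
  have "\<not> arr_indep ?I T" if T: "T \<subseteq> g ` Q" "card T = 3" for T
  proof -
    obtain T' where T': "T' \<subseteq> Q" "T = g ` T'" using T(1) by (meson subset_imageE)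
    have "card T' = 3" using T' T(2) injg by (metis card_image inj_on_subset)
    then obtain x y z where xyz: "T' = {x, y, z}" "x \<noteq> y" "x \<noteq> z" "y \<noteq> z" by (auto simp: card_3_iff)
    then have Q: "x \<in> Q" "y \<in> Q" "z \<in> Q" using T' by auto
    define i where "i = inv_into Q g"
    have i: "i (g x) = x" if "x \<in> Q" for x using that injg by (simp add: i_def)
    \<comment> \<open>The relation of three vectors in a plane: each coefficient is the determinant
      of the other two vectors, so the one at \<open>x\<close> is nonzero.\<close>
    define c where "c t = (if t = x then p y * q z - p z * q y else if t = y then p z * q x - p x * q z
      else p x * q y - p y * q x)" for t
    have rel: "fun_scale (c x) (n x) + (fun_scale (c y) (n y) + fun_scale (c z) (n z)) = 0"
      using xyz(2-4) by (auto simp: c_def n_def fun_scale_def fun_eq_iff algebra_simps)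
    show ?thesis
    proof (rule arr_dependent[OF fin, of T "n \<circ> i" "c \<circ> i" "g x"])
      have T_eq: "T = {g x, g y, g z}" using T' xyz by simp
      then show "finite T" "g x \<in> T" by simp_all
      show "normal_vector ?I H ((n \<circ> i) H)" if "H \<in> T" for H
        using that normal i Q by (auto simp: T_eq)
      show "(\<Sum>H\<in>T. fun_scale ((c \<circ> i) H) ((n \<circ> i) H)) = 0"
        using rel g_ne Q xyz(2-4) by (simp add: T_eq i)
      show "(c \<circ> i) (g x) \<noteq> 0" using cross[OF Q(2,3) xyz(4)] Q i by (simp add: c_def)
    qed
  qed
  moreover have "g ` Q \<subseteq> dirichlet_arrangement V E B u" using gA by blast
  moreover have "card (g ` Q) = 4" using cardO injg by (simp add: card_image)
  ultimately show ?thesis unfolding four_point_line_def by blast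
qed

end

theorem theorem4p4:
  fixes V :: "'v set" and E :: "'v set set" and B :: "'v set"
    and u :: "'v \<Rightarrow> 'k::field_char_0"
  assumes "simple_graph V E" and "connected_graph V E"
    and "B \<subseteq> V" and "card B \<ge> 2"
    and "\<forall>i\<in>B. \<forall>j\<in>B. {i, j} \<notin> E"
    and "inj_on u B"
    and "card E \<ge> 240"
    and "boundary_chromatic_number V E B \<ge> 4"
    and "\<exists>v\<in>V. card {b \<in> B. {v, b} \<in> E} \<ge> 3"
    and "contains_induced (V - B) (delete_verts_edges E B) wheel5_verts wheel5_edges"
  shows
    "(\<forall>n (A' :: (nat \<Rightarrow> 'l::field) set set).
        graphic_arrangement n A' \<longrightarrow>
        \<not> combinatorially_equivalent (dirichlet_index V B) (dirichlet_arrangement V E B u) {1..n} A')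
   \<and> (\<forall>J (A' :: ('j \<Rightarrow> real) set set).
        ideal_arrangement J A' \<longrightarrow>
        \<not> combinatorially_equivalent (dirichlet_index V B) (dirichlet_arrangement V E B u) J A')
   \<and> (\<forall>J (A' :: ('j \<Rightarrow> 'l) set set).
        central_arrangement J A' \<and> hypersolvable J A' \<longrightarrow>
        \<not> combinatorially_equivalent (dirichlet_index V B) (dirichlet_arrangement V E B u) J A')
   \<and> (\<forall>J (A' :: ('j \<Rightarrow> 'l) set set).
        central_arrangement J A' \<and> has_disjoint_minimal_broken_circuits J A' \<longrightarrow>
        \<not> combinatorially_equivalent (dirichlet_index V B) (dirichlet_arrangement V E B u) J A')"
proof -
  let ?I = "dirichlet_index V B" and ?A = "dirichlet_arrangement V E B u"
  have line: "four_point_line ?I ?A"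
    by (rule dirichlet_four_point_line) (fact assms)+
  obtain s r where wheel: "wheel_pattern ?I ?A s r"
    using dirichlet_wheel[OF assms(1,5,10)] by blast
  have 1: "\<not> combinatorially_equivalent ?I ?A {1..n} A'" if "graphic_arrangement n A'"
    for n and A' :: "(nat \<Rightarrow> 'l) set set"
    using four_point_line_transfer[OF line] graphic_no_four_point_line[OF that] by blast
  have 2: "\<not> combinatorially_equivalent ?I ?A J A'" if "ideal_arrangement J A'"
    for J and A' :: "('j \<Rightarrow> real) set set"
    using that combinatorially_equivalentE wheel_pattern_transfer[OF wheel] ideal_no_wheel by metis
  have 3: "\<not> combinatorially_equivalent ?I ?A J A'" if "hypersolvable J A'"
    for J and A' :: "('j \<Rightarrow> 'l) set set"
    using that combinatorially_equivalentE wheel_pattern_transfer[OF wheel] hypersolvable_no_wheel by metis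
  have 4: "\<not> combinatorially_equivalent ?I ?A J A'"
    if "central_arrangement J A'" "has_disjoint_minimal_broken_circuits J A'"
    for J and A' :: "('j \<Rightarrow> 'l) set set"
    using four_point_line_transfer[OF line] disjoint_broken_circuits_no_four_point_line[OF that] by blast
  show ?thesis using 1 2 3 4 by blast
qed

end
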